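(* Let $\Omega_1,\Omega_2\subset\mathbb{R}^n$ be compact, let $\lambda_i$ be a finite non-negative Radon measure on $\Omega_i$ with $\operatorname{spt}\lambda_i=\Omega_i$ ($i=1,2$), and put $\Omega=\Omega_1\times\Omega_2$, $\lambda=\lambda_1\otimes\lambda_2$. Let $c:\Omega\to\mathbb{R}$ be continuous, let $\gamma>0$, and let $\Phi$ be a quasi-Young's function with $\lim_{t\to\infty}\Phi(t)/t=\infty$. For $i=1,2$ let $\mu_i$ be a probability measure on $\Omega_i$ with $\mu_i\ll\lambda_i$ such that $\Phi\big(\tfrac{\mathrm{d}\mu_i}{\mathrm{d}\lambda_i}\big)$ is integrable with respect to $\lambda_i$. If $(\Phi_\infty)^*\big(\tfrac{-c}{\gamma}\big)$ is integrable with respect to $\lambda$, then the predual problem to $$\text{(P)}\qquad \inf_{\substack{\pi\in\mathcal{P}(\Omega),\ \pi\ll\lambda\\ (P_i)_\#\pi=\mu_i,\ i=1,2}}\ \int_\Omega c\,\mathrm{d}\pi+\gamma\int_\Omega \Phi_\infty\Big(\frac{\mathrm{d}\pi}{\mathrm{d}\lambda}\Big)\,\mathrm{d}\lambda$$ is $$\text{(P* )}\qquad \sup_{\alpha_i\in\mathcal{C}(\Omega_i),\ i=1,2}\ \int_{\Omega_1}\alpha_1\,\mathrm{d}\mu_1+\int_{\Omega_2}\alpha_2\,\mathrm{d}\mu_2-\gamma\int_\Omega(\Phi_\infty)^*\Big(\frac{\alpha_1\oplus\alpha_2-c}{\gamma}\Big)\,\mathrm{d}\lambda ,$$ and strong duality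 holds (the optimal values of (P) and (P* ) coincide). Furthermore, if the supremum in (P* ) is finite, then (P) possesses a minimizer.
   Context: $\mathcal{P}(\Omega)$ denotes the probability (Radon) measures on $\Omega$, $\mathcal{C}(\Omega_i)$ the continuous real functions on $\Omega_i$, $P_i:\Omega_1\times\Omega_2\to\Omega_i$ the coordinate projections, $(P_i)_\#\pi$ the push-forward, i.e. the $i$-th marginal of $\pi$. $(\alpha_1\oplus\alpha_2)(x_1,x_2)=\alpha_1(x_1)+\alpha_2(x_2)$. A Young's function is a function $\Phi(t)=\int_0^t\varphi(s)\,\mathrm{d}s$, $t\ge0$, where $\varphi:[0,\infty)\to[0,\infty]$ is increasing (in the weak sense) and lower semi-continuous with $\varphi(0)=0$ and is neither identically zero nor identically infinite on $(0,\infty)$. A quasi-Young's function is a convex, lower semi-continuous $\Phi:[0,\infty)\to\mathbb{R}\cup\{\infty\}$ such that $\Phi_+=\max(\Phi,0)$ is a Young's function. For $g:[0,\infty)\to\mathbb{R}\cup\{\infty\}$, $g_\infty$ is its extension to $\mathbb{R}$ by $g_\infty(x)=g(x)$ for $x\ge0$ and $g_\infty(x)=\infty$ for $x<0$. A superscript $*$ on a function denotes the convex conjugate, $(\Phi_\infty)^*(s)=\sup_{t\in\mathbb{R}}(st-\Phi_\infty(t))$. That (P* ) is the predual problem to (P) means that (P) is the Fenchel dual, with respect to the duality between continuous functions and Radon measures, of problem (P* ). *)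

theory Defs
  imports "HOL-Analysis.Analysis" "HOL-Probability.Probability_Measure"
begin

section \<open>Radon measures and continuous functions on a compact set\<close>

abbreviation borel_on :: "'a::topological_space set \<Rightarrow> 'a measure" where
  "borel_on S \<equiv> restrict_space borel S"

text \<open>On a compact subset of a Euclidean space every finite Borel measure is a Radon measure.\<close>

definition finite_radon :: "'a::topological_space set \<Rightarrow> 'a measure set" where
  "finite_radon S = {M. finite_measure M \<and> sets M = sets (borel_on S)}"

definition prob_radon :: "'a::topological_space set \<Rightarrow> 'a measure set" where
  "prob_radon S = {M. prob_space M \<and> sets M = sets (borel_on S)}"

definition spt :: "'a::topological_space measure \<Rightarrow> 'a set" where
  "spt M = {x \<in> space M. \<forall>U. open U \<longrightarrow> x \<in> U \<longrightarrow> emeasure M (U \<inter> space M) > 0}"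

definition cont_funs :: "'a::topological_space set \<Rightarrow> ('a \<Rightarrow> real) set" where
  "cont_funs S = {f. continuous_on S f}"

text \<open>Signed Radon measures are set functions that are differences of two finite
  non-negative Radon measures; their values on non-Borel sets are irrelevant.
  The integral does not depend on the chosen decomposition.\<close>

definition decomposes ::
    "'a::topological_space set \<Rightarrow> ('a set \<Rightarrow> real) \<Rightarrow> 'a measure \<Rightarrow> 'a measure \<Rightarrow> bool" where
  "decomposes S \<nu> p n \<longleftrightarrow> p \<in> finite_radon S \<and> n \<in> finite_radon S \<and>
     (\<forall>A\<in>sets (borel_on S). \<nu> A = measure p A - measure n A)"

definition signed_radon :: "'a::topological_space set \<Rightarrow> ('a set \<Rightarrow> real) set" where
  "signed_radon S = {\<nu>. \<exists>p n. decomposes S \<nu> p n}"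

definition signed_integral ::
    "'a::topological_space set \<Rightarrow> ('a set \<Rightarrow> real) \<Rightarrow> ('a \<Rightarrow> real) \<Rightarrow> real" where
  "signed_integral S \<nu> f =
     (THE r. \<exists>p n. decomposes S \<nu> p n \<and> r = (\<integral>x. f x \<partial>p) - (\<integral>x. f x \<partial>n))"

section \<open>Integrals of extended real valued functions\<close>

text \<open>If both parts are infinite, then \<open>ereal\<close> arithmetic makes the value \<open>\<infinity>\<close>.\<close>

definition ereal_integral :: "'a measure \<Rightarrow> ('a \<Rightarrow> ereal) \<Rightarrow> ereal" where
  "ereal_integral M f =
     enn2ereal (\<integral>\<^sup>+x. e2ennreal (f x) \<partial>M) - enn2ereal (\<integral>\<^sup>+x. e2ennreal (- f x) \<partial>M)"

definition ereal_integrable :: "'a measure \<Rightarrow> ('a \<Rightarrow> ereal) \<Rightarrow> bool" where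
  "ereal_integrable M f \<longleftrightarrow>
     f \<in> borel_measurable M \<and> (\<integral>\<^sup>+x. e2ennreal \<bar>f x\<bar> \<partial>M) < \<infinity>"

section \<open>Young's functions\<close>

text \<open>Functions on \<open>[0,\<infinity>)\<close> are total functions whose values on negative
  arguments are irrelevant.\<close>

definition lsc_on :: "'a::topological_space set \<Rightarrow> ('a \<Rightarrow> 'b::complete_lattice) \<Rightarrow> bool" where
  "lsc_on S f \<longleftrightarrow> (\<forall>x\<in>S. f x \<le> Liminf (at x within S) f)"

definition ereal_convex_on :: "real set \<Rightarrow> (real \<Rightarrow> ereal) \<Rightarrow> bool" where
  "ereal_convex_on S f \<longleftrightarrow> (\<forall>x\<in>S. \<forall>y\<in>S. \<forall>u\<ge>0. \<forall>v\<ge>0. u + v = 1 \<longrightarrow>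
     f (u * x + v * y) \<le> ereal u * f x + ereal v * f y)"

definition young :: "(real \<Rightarrow> ereal) \<Rightarrow> bool" where
  "young \<Psi> \<longleftrightarrow> (\<exists>\<phi>::real \<Rightarrow> ennreal.
     mono_on {0..} \<phi> \<and> lsc_on {0..} \<phi> \<and> \<phi> 0 = 0 \<and>
     (\<exists>s>0. \<phi> s \<noteq> 0) \<and> (\<exists>s>0. \<phi> s \<noteq> \<infinity>) \<and>
     (\<forall>t\<ge>0. \<Psi> t = enn2ereal (\<integral>\<^sup>+s\<in>{0..t}. \<phi> s \<partial>lborel)))"

definition quasi_young :: "(real \<Rightarrow> ereal) \<Rightarrow> bool" where
  "quasi_young \<Phi> \<longleftrightarrow> (\<forall>t\<ge>0. \<Phi> t \<noteq> -\<infinity>) \<and> ereal_convex_on {0..} \<Phi> \<and>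
     lsc_on {0..} \<Phi> \<and> young (\<lambda>t. max (\<Phi> t) 0)"

definition infty_ext :: "(real \<Rightarrow> ereal) \<Rightarrow> real \<Rightarrow> ereal" where
  "infty_ext g x = (if x \<ge> 0 then g x else \<infinity>)"

definition convex_conj :: "(real \<Rightarrow> ereal) \<Rightarrow> real \<Rightarrow> ereal" where
  "convex_conj f s = (SUP t. ereal (s * t) - f t)"

section \<open>Fenchel duality\<close>

text \<open>Dual vectors are represented by the linear functionals which they induce through the
  duality pairing, so that the adjoint of \<open>K\<close> sends \<open>l\<close> to \<open>l \<circ> K\<close>.\<close>

definition functional_conj :: "'x set \<Rightarrow> ('x \<Rightarrow> ereal) \<Rightarrow> ('x \<Rightarrow> real) \<Rightarrow> ereal" where
  "functional_conj X F l = (SUP x\<in>X. ereal (l x) - F x)"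

text \<open>The Fenchel dual of \<open>sup\<^sub>x -(F x + G (K x))\<close> is the problem
  \<open>inf\<^sub>l F\<^sup>*(-K\<^sup>* l) + G\<^sup>*(l)\<close>. The following is its objective.\<close>

definition fenchel_dual_obj ::
    "'x set \<Rightarrow> ('x \<Rightarrow> ereal) \<Rightarrow> 'y set \<Rightarrow> ('y \<Rightarrow> ereal) \<Rightarrow> ('x \<Rightarrow> 'y) \<Rightarrow> ('y \<Rightarrow> real) \<Rightarrow> ereal" where
  "fenchel_dual_obj X F Y G K l =
     functional_conj X F (\<lambda>x. - l (K x)) + functional_conj Y G l"

section \<open>Regularized optimal transport\<close>

definition oplus :: "('a \<Rightarrow> real) \<times> ('b \<Rightarrow> real) \<Rightarrow> 'a \<times> 'b \<Rightarrow> real" where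
  "oplus \<alpha> z = fst \<alpha> (fst z) + snd \<alpha> (snd z)"

definition P_feasible ::
    "'a::topological_space set \<Rightarrow> 'b::topological_space set \<Rightarrow> ('a \<times> 'b) measure \<Rightarrow>
     'a measure \<Rightarrow> 'b measure \<Rightarrow> ('a \<times> 'b) measure set" where
  "P_feasible \<Omega>1 \<Omega>2 lam \<mu>1 \<mu>2 =
     {\<pi> \<in> prob_radon (\<Omega>1 \<times> \<Omega>2). absolutely_continuous lam \<pi> \<and>
        distr \<pi> (borel_on \<Omega>1) fst = \<mu>1 \<and> distr \<pi> (borel_on \<Omega>2) snd = \<mu>2}"

definition P_obj ::
    "('z \<Rightarrow> real) \<Rightarrow> real \<Rightarrow> (real \<Rightarrow> ereal) \<Rightarrow> 'z measure \<Rightarrow> 'z measure \<Rightarrow> ereal" where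
  "P_obj c \<gamma> \<Phi> lam \<pi> = ereal (\<integral>z. c z \<partial>\<pi>) +
     ereal \<gamma> * ereal_integral lam (\<lambda>z. infty_ext \<Phi> (enn2real (RN_deriv lam \<pi> z)))"

definition Pstar_obj ::
    "('a \<times> 'b \<Rightarrow> real) \<Rightarrow> real \<Rightarrow> (real \<Rightarrow> ereal) \<Rightarrow> ('a \<times> 'b) measure \<Rightarrow> 'a measure \<Rightarrow> 'b measure \<Rightarrow>
     ('a \<Rightarrow> real) \<times> ('b \<Rightarrow> real) \<Rightarrow> ereal" where
  "Pstar_obj c \<gamma> \<Phi> lam \<mu>1 \<mu>2 \<alpha> = ereal ((\<integral>x. fst \<alpha> x \<partial>\<mu>1) + (\<integral>y. snd \<alpha> y \<partial>\<mu>2)) -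
     ereal \<gamma> * ereal_integral lam (\<lambda>z. convex_conj (infty_ext \<Phi>) ((oplus \<alpha> z - c z) / \<gamma>))"

text \<open>\<open>P_obj\<close> is minimized over \<open>P_feasible\<close>, and \<open>Pstar_obj\<close> is maximized over pairs of
  continuous functions. For the Fenchel dual of the latter problem, its objective is split as
  \<open>-(F \<alpha> + G (oplus \<alpha>))\<close>, with the linear map \<open>oplus\<close> and the following \<open>F\<close> and \<open>G\<close>.\<close>

definition Pstar_F ::
    "'a measure \<Rightarrow> 'b measure \<Rightarrow> ('a \<Rightarrow> real) \<times> ('b \<Rightarrow> real) \<Rightarrow> ereal" where
  "Pstar_F \<mu>1 \<mu>2 \<alpha> = ereal (- (\<integral>x. fst \<alpha> x \<partial>\<mu>1) - (\<integral>y. snd \<alpha> y \<partial>\<mu>2))"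

definition Pstar_G ::
    "('z \<Rightarrow> real) \<Rightarrow> real \<Rightarrow> (real \<Rightarrow> ereal) \<Rightarrow> 'z measure \<Rightarrow> ('z \<Rightarrow> real) \<Rightarrow> ereal" where
  "Pstar_G c \<gamma> \<Phi> lam f =
     ereal \<gamma> * ereal_integral lam (\<lambda>z. convex_conj (infty_ext \<Phi>) ((f z - c z) / \<gamma>))"

end

theory Submission
  imports Defs
begin

text \<open>Write \<open>\<psi>\<close> for the conjugate of \<open>\<Phi>\<^sub>\<infinity>\<close>. Superlinearity of \<open>\<Phi>\<close> makes \<open>\<psi>\<close> finite on the whole line, hence
continuous, and \<open>\<psi>\<close> is convex, nonnegative and increasing. So the energy
\<open>f \<mapsto> \<gamma> \<integral> \<psi> ((f - c) / \<gamma>) \<partial>lam\<close> is a finite convex function not only of continuous, but of all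
bounded Borel functions \<open>f\<close> on \<open>\<Omega>\<close>, it is continuous under bounded pointwise convergence, and it stays
bounded along \<open>- k * indicator A\<close> as \<open>k\<close> grows. The proof draws everything from these properties.

\<^item> A linear functional on the bounded Borel functions that is at most the energy plus a constant is
  integration with respect to a finite measure that is absolutely continuous with respect to \<open>lam\<close>
  (\<open>L_eq_integral_rep\<close>, \<open>absolutely_continuous_rep\<close>). Evaluating the bound at large multiples of an
  indicator shows positivity and absolute continuity; evaluating it at large multiples of a
  boundedly null sequence shows \<open>\<sigma>\<close>-additivity.

\<^item> The conjugate of the energy at a measure \<open>\<pi>\<close> with density \<open>h\<close> is
  \<open>\<integral> c \<partial>\<pi> + \<gamma> \<integral> \<Phi>\<^sub>\<infinity> (h) \<partial>lam\<close> (\<open>conjugate_energy\<close>). One inequality is the Young inequality. For the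
  other, \<open>\<Phi>\<^sub>\<infinity> (t)\<close> is the supremum of \<open>q * t - \<psi> q\<close> over rational \<open>q\<close>; a measurable choice of the best
  among finitely many \<open>q\<close> gives bounded test functions, and monotone convergence does the rest. Bounded
  Borel test functions can replace continuous ones because they are generated from continuous
  functions by bounded pointwise limits (\<open>bounded_borel_induct\<close>).

\<^item> For the dual objective at a signed measure \<open>\<nu>\<close>, the part from the linear term is \<open>0\<close> if \<open>\<nu>\<close> has the
  prescribed marginals and \<open>\<infinity>\<close> otherwise, since a linear function on a vector space is bounded above
  only if it vanishes. If the part from the energy is finite, then the first item applies to the
  integral with respect to \<open>\<nu>\<close>. Together with the second item this identifies the dual problem
  (\<open>fenchel_dual_obj_feasible\<close>, \<open>fenchel_dual_obj_infeasible\<close>).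

\<^item> Let the supremum of the predual problem be a real number \<open>s\<close>. On the functions \<open>\<alpha>\<^sub>1 \<oplus> \<alpha>\<^sub>2\<close> the
  integral with respect to the product of the marginals is at most \<open>s\<close> plus the energy. The
  Hahn-Banach theorem for a convex majorant (\<open>hahn_banach_convex\<close>) extends it to all bounded Borel
  functions with the same bound. By the first item the extension is a measure, it has the right
  marginals, and by the second item its cost is at most \<open>s\<close> (\<open>dual_bound_attained\<close>). With weak duality it
  is a minimizer, and there is no duality gap. The supremum is never \<open>- \<infinity>\<close>, and if it is \<open>\<infinity>\<close>, weak duality suffices.\<close>

section \<open>Bounded measurable functions and bounded pointwise limits\<close>

definition bounded_measurable :: "'a measure \<Rightarrow> ('a \<Rightarrow> real) set" where
  "bounded_measurable M = {f \<in> borel_measurable M. \<exists>B. \<forall>x\<in>space M. \<bar>f x\<bar> \<le> B}"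

lemma bounded_measurableI:
  "f \<in> borel_measurable M \<Longrightarrow> (\<And>x. x \<in> space M \<Longrightarrow> \<bar>f x\<bar> \<le> B) \<Longrightarrow> f \<in> bounded_measurable M"
  by (auto simp: bounded_measurable_def)

lemma bounded_measurable_measurable [measurable_dest]:
  "f \<in> bounded_measurable M \<Longrightarrow> f \<in> borel_measurable M"
  by (simp add: bounded_measurable_def)

lemma bounded_measurable_indicator:
  "A \<in> sets M \<Longrightarrow> (indicator A :: _ \<Rightarrow> real) \<in> bounded_measurable M"
  by (rule bounded_measurableI[of _ _ 1]) (auto simp: indicator_def)

lemma bounded_measurable_const: "(\<lambda>x. a) \<in> bounded_measurable M"
  by (rule bounded_measurableI[of _ _ "\<bar>a\<bar>"]) auto

lemma bounded_measurable_lincomb: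
  assumes "f \<in> bounded_measurable M" "g \<in> bounded_measurable M"
  shows "(\<lambda>x. a * f x + b * g x) \<in> bounded_measurable M"
proof -
  obtain B C where "\<And>x. x \<in> space M \<Longrightarrow> \<bar>f x\<bar> \<le> B" "\<And>x. x \<in> space M \<Longrightarrow> \<bar>g x\<bar> \<le> C"
    using assms by (auto simp: bounded_measurable_def)
  then have "\<bar>a * f x + b * g x\<bar> \<le> \<bar>a\<bar> * B + \<bar>b\<bar> * C" if "x \<in> space M" for x
    using that by (intro order_trans[OF abs_triangle_ineq]) (auto simp: abs_mult intro!: add_mono mult_left_mono)
  then show ?thesis
    using assms by (intro bounded_measurableI) (auto dest: bounded_measurable_measurable)
qed

lemma bounded_measurable_lim:
  assumes "\<And>n. F n \<in> borel_measurable M" "\<And>n x. x \<in> space M \<Longrightarrow> \<bar>F n x\<bar> \<le> B"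
    and lim: "\<And>x. x \<in> space M \<Longrightarrow> (\<lambda>n. F n x) \<longlonglongrightarrow> f x"
  shows "f \<in> bounded_measurable M"
proof (rule bounded_measurableI)
  show "f \<in> borel_measurable M"
    by (rule borel_measurable_LIMSEQ_real[OF lim assms(1)])
  show "\<bar>f x\<bar> \<le> B" if "x \<in> space M" for x
    by (rule LIMSEQ_le_const2[OF tendsto_rabs[OF lim[OF that]]]) (use assms(2) that in auto)
qed

lemma (in finite_measure) bounded_measurable_integrable:
  assumes "f \<in> bounded_measurable M" shows "integrable M f"
proof -
  obtain B where "\<And>x. x \<in> space M \<Longrightarrow> \<bar>f x\<bar> \<le> B" "f \<in> borel_measurable M"
    using assms by (auto simp: bounded_measurable_def)
  then show ?thesis
    by (intro integrable_const_bound[of _ B]) auto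
qed

lemma (in finite_measure) bounded_convergence:
  fixes F :: "nat \<Rightarrow> 'a \<Rightarrow> real"
  assumes F: "\<And>n. F n \<in> borel_measurable M" "\<And>n x. x \<in> space M \<Longrightarrow> \<bar>F n x\<bar> \<le> B"
    and lim: "\<And>x. x \<in> space M \<Longrightarrow> (\<lambda>n. F n x) \<longlonglongrightarrow> f x"
  shows "(\<lambda>n. \<integral>x. F n x \<partial>M) \<longlonglongrightarrow> (\<integral>x. f x \<partial>M)"
proof (rule integral_dominated_convergence[where w="\<lambda>_. B"])
  show "f \<in> borel_measurable M"
    using bounded_measurable_lim[OF F lim] by (rule bounded_measurable_measurable)
qed (use assms in auto)

text \<open>A bounded measurable function is a bounded pointwise limit of simple functions, and those are linear
combinations of indicators. The closure under limits also yields that \<open>P\<close> depends only on the values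
on \<open>space M\<close>.\<close>

lemma bounded_measurable_induct [consumes 1, case_names indicator lincomb lim]:
  assumes f: "f \<in> bounded_measurable M"
    and indicator: "\<And>A. A \<in> sets M \<Longrightarrow> P (indicator A)"
    and lincomb: "\<And>f g a b. f \<in> bounded_measurable M \<Longrightarrow> g \<in> bounded_measurable M \<Longrightarrow> P f \<Longrightarrow> P g \<Longrightarrow>
        P (\<lambda>x. a * f x + b * g x)"
    and lim: "\<And>F f B. (\<And>n. F n \<in> bounded_measurable M) \<Longrightarrow> (\<And>n. P (F n)) \<Longrightarrow>
        (\<And>n x. x \<in> space M \<Longrightarrow> \<bar>F n x\<bar> \<le> B) \<Longrightarrow>
        (\<And>x. x \<in> space M \<Longrightarrow> (\<lambda>n. F n x) \<longlonglongrightarrow> f x) \<Longrightarrow> P f"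
  shows "P f"
proof -
  have sums: "(\<lambda>x. \<Sum>y\<in>Y. y * indicator (A y) x) \<in> bounded_measurable M
      \<and> P (\<lambda>x. \<Sum>y\<in>Y. y * indicator (A y) x)"
    if "finite Y" "\<And>y. A y \<in> sets M" for Y and A :: "real \<Rightarrow> 'a set"
    using that(1)
  proof induction
    case empty
    \<comment> \<open>The premises reach the zero function as a linear combination of indicators.\<close>
    have "P (\<lambda>x. 0 * indicator {} x + 0 * indicator {} x)"
      by (intro lincomb indicator bounded_measurable_indicator) auto
    then show ?case by (simp add: bounded_measurable_const)
  next
    case (insert y Y)
    have "P (\<lambda>x. y * indicator (A y) x + 1 * (\<Sum>y\<in>Y. y * indicator (A y) x))"
      using insert that(2) by (intro lincomb indicator bounded_measurable_indicator) auto
    moreover have "(\<lambda>x. y * indicator (A y) x + 1 * (\<Sum>y\<in>Y. y * indicator (A y) x)) \<in> bounded_measurable M"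
      using insert that(2) by (intro bounded_measurable_lincomb bounded_measurable_indicator) auto
    ultimately show ?case
      by (simp only: sum.insert[OF insert(1,2)] mult_1 simp_thms)
  qed
  have simple: "g \<in> bounded_measurable M \<and> P g" if g: "simple_function M g" for g :: "'a \<Rightarrow> real"
  proof -
    \<comment> \<open>\<open>h\<close> equals \<open>g\<close> only on \<open>space M\<close>; the constant sequence \<open>h\<close> transports \<open>P\<close> to \<open>g\<close>.\<close>
    define h where "h = (\<lambda>x. \<Sum>y\<in>g ` space M. y * indicator (g -` {y} \<inter> space M) x)"
    have fin: "finite (g ` space M)" using g by (rule simple_functionD)
    have h: "h \<in> bounded_measurable M" "P h"
      using sums[OF fin, of "\<lambda>y. g -` {y} \<inter> space M"] simple_functionD(2)[OF g] by (auto simp: h_def)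
    have hg: "h x = g x" if "x \<in> space M" for x
    proof -
      have "h x = (\<Sum>y\<in>g ` space M. if y = g x then y else 0)"
        unfolding h_def using that by (intro sum.cong) (auto simp: indicator_def)
      then show ?thesis using fin that by simp
    qed
    obtain B where B: "\<And>x. x \<in> space M \<Longrightarrow> \<bar>h x\<bar> \<le> B"
      using h by (auto simp: bounded_measurable_def)
    have "P g"
    proof (rule lim[of "\<lambda>_. h" B])
      show "(\<lambda>_. h x) \<longlonglongrightarrow> g x" if "x \<in> space M" for x
        using hg[OF that] by simp
    qed (fact h B)+
    moreover have "g \<in> bounded_measurable M"
      using borel_measurable_simple_function[OF g] B by (intro bounded_measurableI[of _ _ B]) (simp_all add: hg)
    ultimately show ?thesis by simp
  qed
  obtain B where fB: "\<And>x. x \<in> space M \<Longrightarrow> \<bar>f x\<bar> \<le> B" and fm: "f \<in> borel_measurable M"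
    using f by (auto simp: bounded_measurable_def)
  from borel_measurable_implies_sequence_metric[OF fm, of 0] obtain F where
    F: "\<And>i. simple_function M (F i)" "\<And>x. x \<in> space M \<Longrightarrow> (\<lambda>i. F i x) \<longlonglongrightarrow> f x"
    "\<And>i x. x \<in> space M \<Longrightarrow> \<bar>F i x\<bar> \<le> 2 * \<bar>f x\<bar>"
    by (simp add: dist_real_def) metis
  show ?thesis
  proof (rule lim[of F "2 * B" f])
    show "\<bar>F n x\<bar> \<le> 2 * B" if "x \<in> space M" for n x
      using F(3)[OF that, of n] fB[OF that] by linarith
  qed (use F simple in auto)
qed

lemma bounded_measurable_cong_sets:
  assumes "sets M = sets N" shows "bounded_measurable M = bounded_measurable N"
  unfolding bounded_measurable_def
  using measurable_cong_sets[of M N borel borel] sets_eq_imp_space_eq[OF assms] assms by auto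

lemma finite_radonD:
  assumes "M \<in> finite_radon S"
  shows "finite_measure M" "sets M = sets (borel_on S)" "space M = S"
    "bounded_measurable M = bounded_measurable (borel_on S)"
proof -
  show "finite_measure M" and sets: "sets M = sets (borel_on S)"
    using assms by (auto simp: finite_radon_def)
  show "space M = S"
    using sets_eq_imp_space_eq[OF sets] by (simp add: space_restrict_space)
  show "bounded_measurable M = bounded_measurable (borel_on S)"
    using sets by (rule bounded_measurable_cong_sets)
qed

lemma prob_radon_imp_finite_radon: "M \<in> prob_radon S \<Longrightarrow> M \<in> finite_radon S"
  by (auto simp: prob_radon_def finite_radon_def prob_space.finite_measure)

lemma null_measure_finite_radon: "null_measure (borel_on S) \<in> finite_radon S"
  by (auto simp: finite_radon_def intro: finite_measureI)

lemma finite_radon_integrable: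
  "M \<in> finite_radon S \<Longrightarrow> f \<in> bounded_measurable (borel_on S) \<Longrightarrow> integrable M f"
  using finite_measure.bounded_measurable_integrable[of M f] finite_radonD[of M S] by simp

lemma finite_radon_bounded_convergence:
  assumes M: "M \<in> finite_radon S" and F: "\<And>n. F n \<in> bounded_measurable (borel_on S)"
    and "\<And>n x. x \<in> S \<Longrightarrow> \<bar>F n x\<bar> \<le> B" "\<And>x. x \<in> S \<Longrightarrow> (\<lambda>n. F n x) \<longlonglongrightarrow> f x"
  shows "(\<lambda>n. \<integral>x. F n x \<partial>M) \<longlonglongrightarrow> (\<integral>x. f x \<partial>M)"
proof (rule finite_measure.bounded_convergence[where B=B])
  show "F n \<in> borel_measurable M" for n
    using F[of n] unfolding finite_radonD(4)[OF M, symmetric] by (rule bounded_measurable_measurable)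
qed (use assms finite_radonD[OF M] in auto)

lemma continuous_bounded_measurable:
  fixes S :: "'a::topological_space set"
  assumes "compact S" "continuous_on S f"
  shows "f \<in> bounded_measurable (borel_on S)"
proof -
  have "bounded (f ` S)" using assms compact_continuous_image compact_imp_bounded by blast
  then obtain B where "\<And>x. x \<in> S \<Longrightarrow> \<bar>f x\<bar> \<le> B" by (auto simp: bounded_real)
  then show ?thesis
    using assms by (intro bounded_measurableI[of _ _ B] borel_measurable_continuous_on_restrict)
      (auto simp: space_restrict_space)
qed

text \<open>The bounded Baire functions, encoded by their values on \<open>S\<close>. They form an auxiliary class between the
continuous and the bounded Borel functions; unlike the functions that satisfy a given inequality, they
are closed under linear combinations, which is what a Dynkin argument needs.\<close>

inductive_set baire_class :: "'a::topological_space set \<Rightarrow> ('a \<Rightarrow> real) set" for S where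
  continuous: "continuous_on S f \<Longrightarrow> f \<in> baire_class S"
| limit: "(\<And>n. F n \<in> baire_class S) \<Longrightarrow> (\<And>n x. x \<in> S \<Longrightarrow> \<bar>F n x\<bar> \<le> B) \<Longrightarrow>
    (\<And>x. x \<in> S \<Longrightarrow> (\<lambda>n. F n x) \<longlonglongrightarrow> f x) \<Longrightarrow> f \<in> baire_class S"

lemma baire_class_bounded_measurable:
  assumes "compact S" "f \<in> baire_class S"
  shows "f \<in> bounded_measurable (borel_on S)"
  using assms(2)
proof induction
  case (continuous f)
  then show ?case using assms(1) by (rule continuous_bounded_measurable[rotated])
next
  case (limit F B f)
  show ?case
    by (rule bounded_measurable_lim[of F _ B])
      (use limit in \<open>auto simp: space_restrict_space dest: bounded_measurable_measurable\<close>)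
qed

text \<open>Two nested inductions: for fixed continuous \<open>g\<close> the claim passes to limits in \<open>f\<close>, and then for fixed
Baire \<open>f\<close> it passes to limits in \<open>g\<close>.\<close>

lemma baire_class_lincomb:
  assumes S: "compact S" and f: "f \<in> baire_class S" and g: "g \<in> baire_class S"
  shows "(\<lambda>x. a * f x + b * g x) \<in> baire_class S"
proof -
  have bdd: "\<exists>B. \<forall>x\<in>S. \<bar>f x\<bar> \<le> B" if "f \<in> baire_class S" for f
    using baire_class_bounded_measurable[OF S that]
    by (auto simp: bounded_measurable_def space_restrict_space)
  have lim: "(\<lambda>x. a * f x + b * g x) \<in> baire_class S"
    if "\<And>n. (\<lambda>x. a * F n x + b * g x) \<in> baire_class S" "\<And>n x. x \<in> S \<Longrightarrow> \<bar>F n x\<bar> \<le> B"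
      "\<And>x. x \<in> S \<Longrightarrow> (\<lambda>n. F n x) \<longlonglongrightarrow> f x" and g: "g \<in> baire_class S"
    for F f g B and a b :: real
  proof -
    obtain C where C: "\<And>x. x \<in> S \<Longrightarrow> \<bar>g x\<bar> \<le> C" using bdd[OF g] by auto
    show ?thesis
    proof (rule baire_class.limit[of "\<lambda>n x. a * F n x + b * g x" S "\<bar>a\<bar> * B + \<bar>b\<bar> * C"])
      fix n x assume "x \<in> S"
      then show "\<bar>a * F n x + b * g x\<bar> \<le> \<bar>a\<bar> * B + \<bar>b\<bar> * C"
        using that(2) C by (intro order_trans[OF abs_triangle_ineq]) (auto simp: abs_mult intro!: add_mono mult_left_mono)
    qed (use that g in \<open>auto intro!: tendsto_intros\<close>)
  qed
  have 1: "(\<lambda>x. a * f x + b * g x) \<in> baire_class S"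
    if "f \<in> baire_class S" "continuous_on S g" for f g and a b :: real
    using that(1)
  proof induction
    case (continuous f)
    then show ?case using that(2) by (intro baire_class.continuous continuous_intros)
  next
    case (limit F B f)
    show ?case by (rule lim[OF limit(4,2,3)]) (use that in \<open>auto intro: baire_class.continuous\<close>)
  qed
  show ?thesis
    using g
  proof induction
    case (continuous g)
    then show ?case using f by (intro 1)
  next
    case (limit G B g)
    have "(\<lambda>x. b * g x + a * f x) \<in> baire_class S"
      by (rule lim[of b G a f B]) (use limit f in \<open>auto simp: add.commute\<close>)
    then show ?case by (simp add: add.commute)
  qed
qed

lemma tendsto_indicator_closed:
  fixes x :: "'a::metric_space"
  assumes "closed C" "C \<noteq> {}"
  shows "(\<lambda>n. max 0 (1 - real n * infdist x C)) \<longlonglongrightarrow> indicator C x"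
proof (cases "x \<in> C")
  case False
  then have pos: "infdist x C > 0"
    using assms by (metis in_closed_iff_infdist_zero infdist_nonneg order_le_less)
  have "\<forall>\<^sub>F n in sequentially. max 0 (1 - real n * infdist x C) = 0"
  proof -
    obtain N where N: "1 / infdist x C < real N" using reals_Archimedean2 by blast
    show ?thesis
    proof (rule eventually_sequentiallyI[of N])
      fix n assume "N \<le> n"
      then have "1 / infdist x C < real n" using N by linarith
      then show "max 0 (1 - real n * infdist x C) = 0" using pos by (simp add: field_simps)
    qed
  qed
  then show ?thesis using False by (simp add: tendsto_eventually)
qed simp

text \<open>The closed sets form an intersection-stable generator of the Borel sets, and the indicator of a closed
set is a limit of continuous functions of the distance to it. Complements and disjoint countable unions
correspond to linear combinations and bounded limits of indicators.\<close>

lemma baire_class_indicator: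
  fixes S :: "'a::metric_space set"
  assumes S: "compact S" and A: "A \<in> sets borel"
  shows "indicator A \<in> baire_class S"
proof -
  have lincomb: "(\<lambda>x. a * f x + b * g x) \<in> baire_class S"
    if "f \<in> baire_class S" "g \<in> baire_class S" for f g a b
    using baire_class_lincomb[OF S that] .
  have "A \<in> sigma_sets UNIV (Collect closed)"
    using A by (simp add: borel_eq_closed)
  show ?thesis
  proof (rule sigma_sets_induct_disjoint[where P="\<lambda>A. indicator A \<in> baire_class S"])
    show "A \<in> sigma_sets UNIV (Collect closed)" by fact
    show "Int_stable (Collect closed :: 'a set set)" by (auto simp: Int_stable_def)
  next
    fix C :: "'a set" assume "C \<in> Collect closed"
    then have C: "closed C" by simp
    show "indicator C \<in> baire_class S"
    proof (cases "C = {}")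
      case True
      then show ?thesis by (intro baire_class.continuous) simp
    next
      case False
      show ?thesis
      proof (rule baire_class.limit[of "\<lambda>n x. max 0 (1 - real n * infdist x C)" S 1 "indicator C"])
        show "(\<lambda>x. max 0 (1 - real n * infdist x C)) \<in> baire_class S" for n
          by (intro baire_class.continuous continuous_intros)
        show "\<bar>max 0 (1 - real n * infdist x C)\<bar> \<le> 1" for n x
          using mult_nonneg_nonneg[OF of_nat_0_le_iff infdist_nonneg, of n x C] by linarith
      qed (rule tendsto_indicator_closed[OF C False])
    qed
  next
    show "indicator {} \<in> baire_class S" by (intro baire_class.continuous) simp
  next
    fix A :: "'a set" assume "indicator A \<in> baire_class S"
    then have "(\<lambda>x. 1 * 1 + (-1) * indicator A x) \<in> baire_class S"
      by (intro lincomb) (auto intro: baire_class.continuous)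
    moreover have "(\<lambda>x. 1 * 1 + (-1) * indicator A x :: real) = indicator (UNIV - A)"
      by (auto simp: indicator_def)
    ultimately show "indicator (UNIV - A) \<in> baire_class S" by metis
  next
    fix A :: "nat \<Rightarrow> 'a set"
    assume dis: "disjoint_family A" and ind: "\<And>i. indicator (A i) \<in> baire_class S"
    have fin: "indicator (\<Union>i<n. A i) \<in> baire_class S" for n
    proof (induction n)
      case 0
      show ?case by (intro baire_class.continuous) simp
    next
      case (Suc n)
      have "(\<Union>i<n. A i) \<inter> A n = {}"
        using dis by (auto simp: disjoint_family_on_def) (metis IntI empty_iff less_irrefl)
      then have "indicator (\<Union>i<Suc n. A i) = (\<lambda>x. 1 * indicator (\<Union>i<n. A i) x + 1 * indicator (A n) x :: real)"
        by (auto simp: indicator_def fun_eq_iff lessThan_Suc)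
      then show ?case using lincomb[OF Suc ind, of 1 1] by simp
    qed
    show "indicator (\<Union>i. A i) \<in> baire_class S"
      by (rule baire_class.limit[of "\<lambda>n. indicator (\<Union>i<n. A i)" S 1])
        (use fin LIMSEQ_indicator_UN[of A] in \<open>auto simp: indicator_le_1\<close>)
  qed auto
qed

lemma bounded_borel_imp_baire_class:
  fixes S :: "'a::metric_space set"
  assumes S: "compact S" and f: "f \<in> bounded_measurable (borel_on S)"
  shows "f \<in> baire_class S"
  using f
proof (induction rule: bounded_measurable_induct)
  case (indicator A)
  then obtain B where B: "B \<in> sets borel" "A = S \<inter> B" by (auto simp: sets_restrict_space)
  moreover have "S \<in> sets borel" using S by (simp add: compact_imp_closed)
  ultimately show ?case using baire_class_indicator[OF S, of A] by auto
next
  case (lincomb f g a b)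
  then show ?case using baire_class_lincomb[OF S] by blast
next
  case (lim F f B)
  then show ?case by (intro baire_class.limit[of F S B f]) (auto simp: space_restrict_space)
qed

text \<open>An inequality between functionals that are continuous under bounded pointwise convergence carries over
from continuous to bounded Borel functions by this rule, although the functions that satisfy it do not
form a vector space.\<close>

lemma bounded_borel_induct [consumes 2, case_names continuous lim]:
  fixes S :: "'a::metric_space set"
  assumes S: "compact S" and f: "f \<in> bounded_measurable (borel_on S)"
    and continuous: "\<And>f. continuous_on S f \<Longrightarrow> P f"
    and lim: "\<And>F f B. (\<And>n. F n \<in> bounded_measurable (borel_on S)) \<Longrightarrow> (\<And>n. P (F n)) \<Longrightarrow>
        (\<And>n x. x \<in> S \<Longrightarrow> \<bar>F n x\<bar> \<le> B) \<Longrightarrow>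
        (\<And>x. x \<in> S \<Longrightarrow> (\<lambda>n. F n x) \<longlonglongrightarrow> f x) \<Longrightarrow> P f"
  shows "P f"
  using bounded_borel_imp_baire_class[OF S f]
proof induction
  case (continuous f) then show ?case by (rule assms(3))
next
  case (limit F B f)
  show ?case by (rule lim[of F B f]) (use limit baire_class_bounded_measurable[OF S] in auto)
qed

lemma measure_eq_if_continuous_integrals_eq:
  fixes S :: "'a::metric_space set"
  assumes S: "compact S" and M: "M \<in> finite_radon S" and N: "N \<in> finite_radon S"
    and eq: "\<And>f :: 'a \<Rightarrow> real. continuous_on S f \<Longrightarrow> (\<integral>x. f x \<partial>M) = (\<integral>x. f x \<partial>N)"
  shows "M = N"
proof (rule measure_eqI)
  interpret M: finite_measure M using M by (rule finite_radonD)
  interpret N: finite_measure N using N by (rule finite_radonD)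
  have sets: "sets M = sets (borel_on S)" "sets N = sets (borel_on S)"
    using M N by (auto simp: finite_radon_def)
  then show "sets M = sets N" by simp
  have all: "(\<integral>x. f x \<partial>M) = (\<integral>x. f x \<partial>N)" if "f \<in> bounded_measurable (borel_on S)" for f
    using S that
  proof (induction rule: bounded_borel_induct)
    case (continuous f)
    then show ?case by (rule eq)
  next
    case (lim F f B)
    have "(\<lambda>n. \<integral>x. F n x \<partial>M) \<longlonglongrightarrow> (\<integral>x. f x \<partial>M)"
      using M lim(1-3) by (rule finite_radon_bounded_convergence)
    moreover have "(\<lambda>n. \<integral>x. F n x \<partial>M) \<longlonglongrightarrow> (\<integral>x. f x \<partial>N)"
      unfolding lim(4) using N lim(1-3) by (rule finite_radon_bounded_convergence)
    ultimately show ?case by (rule LIMSEQ_unique)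
  qed
  fix A assume A: "A \<in> sets M"
  then have "measure M A = measure N A"
    using all[OF bounded_measurable_indicator, of A] sets by simp
  then show "emeasure M A = emeasure N A"
    by (simp add: M.emeasure_eq_measure N.emeasure_eq_measure)
qed

section \<open>The Hahn-Banach theorem with a convex majorant\<close>

text \<open>A partially defined linear functional is handled as its graph, so that extension is inclusion and the
union of a chain is an upper bound. A linear relation below a finite majorant is automatically single
valued.\<close>

definition linear_graph :: "(('z \<Rightarrow> real) \<times> real) set \<Rightarrow> bool" where
  "linear_graph H \<longleftrightarrow> ((\<lambda>_. 0), 0) \<in> H \<and> (\<forall>f r g s a b. (f, r) \<in> H \<longrightarrow> (g, s) \<in> H \<longrightarrow>
     ((\<lambda>z. a * f z + b * g z), a * r + b * s) \<in> H)"

lemma linear_graphD: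
  "linear_graph H \<Longrightarrow> (f, r) \<in> H \<Longrightarrow> (g, s) \<in> H \<Longrightarrow> ((\<lambda>z. a * f z + b * g z), a * r + b * s) \<in> H"
  by (auto simp: linear_graph_def)

text \<open>The value \<open>a\<close> of the extended functional at \<open>e\<close> has to satisfy lower bounds, from negative
multiples of \<open>e\<close>, and upper bounds, from positive ones. Each lower bound is below each upper bound:
a suitable convex combination of the two points involved lies in the domain of \<open>H\<close>, where \<open>p\<close>
is a majorant.\<close>

lemma linear_graph_slope_exists:
  fixes p :: "('z \<Rightarrow> real) \<Rightarrow> real"
  assumes H: "linear_graph H" "\<And>f r. (f, r) \<in> H \<Longrightarrow> r \<le> p f" "\<And>f r. (f, r) \<in> H \<Longrightarrow> f \<in> X"
    and X: "\<And>f g a b. f \<in> X \<Longrightarrow> g \<in> X \<Longrightarrow> (\<lambda>z. a * f z + b * g z) \<in> X"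
    and p: "\<And>f g u. f \<in> X \<Longrightarrow> g \<in> X \<Longrightarrow> 0 \<le> u \<Longrightarrow> u \<le> 1 \<Longrightarrow>
        p (\<lambda>z. (1 - u) * f z + u * g z) \<le> (1 - u) * p f + u * p g"
    and e: "e \<in> X"
  shows "\<exists>a. \<forall>(f, r) \<in> H. \<forall>t. r + t * a \<le> p (\<lambda>z. f z + t * e z)"
proof -
  have X1: "(\<lambda>z. f z + t * e z) \<in> X" if "f \<in> X" for f t
    using X[OF that e, of 1 t] by simp
  have key: "(r - p (\<lambda>z. f z - t * e z)) / t \<le> (p (\<lambda>z. g z + s * e z) - q) / s"
    if "(f, r) \<in> H" "(g, q) \<in> H" "t > 0" "s > 0" for f g r q s t
  proof -
    \<comment> \<open>With this weight the multiples \<open>- t\<close> and \<open>s\<close> of \<open>e\<close> cancel.\<close>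
    define u where "u = t / (s + t)"
    have u: "0 \<le> u" "u \<le> 1" "1 - u = s / (s + t)" "s + t > 0" using that by (auto simp: u_def field_simps)
    have "(1 - u) * r + u * q \<le> p (\<lambda>z. (1 - u) * f z + u * g z)"
      using linear_graphD[OF H(1) that(1,2)] by (intro H(2))
    also have "(\<lambda>z. (1 - u) * f z + u * g z) =
        (\<lambda>z. (1 - u) * (f z + (-t) * e z) + u * (g z + s * e z))"
      using u(4) by (simp add: fun_eq_iff u(3)) (simp add: u_def field_simps)
    also have "p \<dots> \<le> (1 - u) * p (\<lambda>z. f z + (-t) * e z) + u * p (\<lambda>z. g z + s * e z)"
      using that H(3) u by (intro p X1) auto
    finally have "(s * r + t * q) / (s + t) \<le>
        (s * p (\<lambda>z. f z - t * e z) + t * p (\<lambda>z. g z + s * e z)) / (s + t)"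
      by (simp add: u(3)) (simp add: u_def add_divide_distrib)
    then have "s * r + t * q \<le> s * p (\<lambda>z. f z - t * e z) + t * p (\<lambda>z. g z + s * e z)"
      using u(4) by (simp add: divide_le_cancel)
    then show ?thesis using that(3,4) by (simp add: field_simps)
  qed
  define L where "L = {(r - p (\<lambda>z. f z - t * e z)) / t | f r t. (f, r) \<in> H \<and> t > 0}"
  have H0: "((\<lambda>_. 0), 0) \<in> H" using H(1) by (simp add: linear_graph_def)
  have L: "L \<noteq> {}" unfolding L_def using H0 zero_less_one by blast
  have "bdd_above L"
    unfolding L_def using key[OF _ H0, of _ _ _ 1] by (intro bdd_aboveI) auto
  define a where "a = Sup L"
  have lower: "(r - p (\<lambda>z. f z - t * e z)) / t \<le> a" if "(f, r) \<in> H" "t > 0" for f r t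
    unfolding a_def using that \<open>bdd_above L\<close> by (intro cSup_upper) (auto simp: L_def)
  have upper: "a \<le> (p (\<lambda>z. g z + s * e z) - q) / s" if "(g, q) \<in> H" "s > 0" for g q s
    unfolding a_def using L key that by (intro cSup_least) (auto simp: L_def)
  have "r + t * a \<le> p (\<lambda>z. f z + t * e z)" if "(f, r) \<in> H" for f r t
  proof (cases t "0 :: real" rule: linorder_cases)
    case less
    then show ?thesis using lower[OF that, of "-t"] by (simp add: field_simps)
  next
    case equal
    then show ?thesis using H(2)[OF that] by simp
  next
    case greater
    then show ?thesis using upper[OF that, of t] by (simp add: field_simps)
  qed
  then show ?thesis by auto
qed

lemma linear_graph_extend:
  assumes "linear_graph H"
  shows "linear_graph {((\<lambda>z. f z + t * e z), r + t * a) | f r t. (f, r) \<in> H}" (is "linear_graph ?E")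
  unfolding linear_graph_def
proof (intro conjI allI impI)
  show "((\<lambda>_. 0), 0) \<in> ?E"
    using assms by (auto simp: linear_graph_def intro!: exI[of _ "\<lambda>_. 0"] exI[of _ "0 :: real"])
next
  fix f r g s and x y :: real
  assume "(f, r) \<in> ?E" "(g, s) \<in> ?E"
  then obtain f' r' t g' s' t' where *: "(f', r') \<in> H" "f = (\<lambda>z. f' z + t * e z)" "r = r' + t * a"
    "(g', s') \<in> H" "g = (\<lambda>z. g' z + t' * e z)" "s = s' + t' * a" by blast
  have E: "((\<lambda>z. h z + k * e z), q + k * a) \<in> ?E" if "(h, q) \<in> H" for h q k
    by (rule CollectI, intro exI conjI, rule refl, rule that)
  have "((\<lambda>z. (x * f' z + y * g' z) + (x * t + y * t') * e z), (x * r' + y * s') + (x * t + y * t') * a) \<in> ?E"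
    by (rule E[OF linear_graphD[OF assms *(1,4)]])
  then show "((\<lambda>z. x * f z + y * g z), x * r + y * s) \<in> ?E"
    by (simp add: * algebra_simps)
qed

text \<open>Zorn's lemma for the linear graphs that extend the given functional and lie below \<open>p\<close>. A maximal one
has full domain because it could be extended otherwise. It is single valued because its vertical
part is a linear space below the number \<open>p 0\<close>. The majorant is only convex, not sublinear, so that the
theorem applies to \<open>p = s + energy\<close> directly.\<close>

theorem hahn_banach_convex:
  fixes p l :: "('z \<Rightarrow> real) \<Rightarrow> real"
  assumes X: "(\<lambda>_. 0) \<in> X" "\<And>f g a b. f \<in> X \<Longrightarrow> g \<in> X \<Longrightarrow> (\<lambda>z. a * f z + b * g z) \<in> X"
    and p: "\<And>f g u. f \<in> X \<Longrightarrow> g \<in> X \<Longrightarrow> 0 \<le> u \<Longrightarrow> u \<le> 1 \<Longrightarrow>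
        p (\<lambda>z. (1 - u) * f z + u * g z) \<le> (1 - u) * p f + u * p g"
    and V: "V \<subseteq> X" "(\<lambda>_. 0) \<in> V" "\<And>f g a b. f \<in> V \<Longrightarrow> g \<in> V \<Longrightarrow> (\<lambda>z. a * f z + b * g z) \<in> V"
    and l: "\<And>f g a b. f \<in> V \<Longrightarrow> g \<in> V \<Longrightarrow> l (\<lambda>z. a * f z + b * g z) = a * l f + b * l g"
    and lp: "\<And>f. f \<in> V \<Longrightarrow> l f \<le> p f"
  obtains L where "\<And>f g a b. f \<in> X \<Longrightarrow> g \<in> X \<Longrightarrow> L (\<lambda>z. a * f z + b * g z) = a * L f + b * L g"
    and "\<And>f. f \<in> X \<Longrightarrow> L f \<le> p f" and "\<And>f. f \<in> V \<Longrightarrow> L f = l f"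
proof -
  define H0 where "H0 = (\<lambda>f. (f, l f)) ` V"
  define dominated where
    "dominated = {H. linear_graph H \<and> H0 \<subseteq> H \<and> (\<forall>(f, r) \<in> H. f \<in> X \<and> r \<le> p f)}"
  have "l (\<lambda>_. 0) = 0"
    using l[OF V(2,2), of 0 0] by simp
  then have "H0 \<in> dominated"
    using V l lp by (fastforce simp: dominated_def H0_def linear_graph_def image_iff)
  moreover have "\<Union>C \<in> dominated" if C: "C \<noteq> {}" "subset.chain dominated C" for C
  proof -
    have sub: "H \<in> dominated" if "H \<in> C" for H using C(2) that by (auto simp: subset.chain_def)
    have "linear_graph (\<Union>C)"
      unfolding linear_graph_def
    proof (intro conjI allI impI)
      show "((\<lambda>_. 0), 0) \<in> \<Union>C" using C(1) sub by (fastforce simp: dominated_def linear_graph_def)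
    next
      fix f r g s a b assume "(f, r) \<in> \<Union>C" "(g, s) \<in> \<Union>C"
      then obtain H G where "H \<in> C" "(f, r) \<in> H" "G \<in> C" "(g, s) \<in> G" by blast
      moreover then have "H \<subseteq> G \<or> G \<subseteq> H" using C(2) by (auto simp: subset.chain_def)
      ultimately obtain K where "K \<in> C" "(f, r) \<in> K" "(g, s) \<in> K" by blast
      then show "((\<lambda>z. a * f z + b * g z), a * r + b * s) \<in> \<Union>C"
        using sub[of K] linear_graphD[of K f r g s a b] by (auto simp: dominated_def)
    qed
    then show ?thesis using C(1) sub by (fastforce simp: dominated_def)
  qed
  ultimately obtain H where H: "H \<in> dominated" and max: "\<And>G. G \<in> dominated \<Longrightarrow> H \<subseteq> G \<Longrightarrow> G = H"
    using subset_Zorn_nonempty[of dominated] by blast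
  have lin: "linear_graph H" and H0: "H0 \<subseteq> H" and HX: "\<And>f r. (f, r) \<in> H \<Longrightarrow> f \<in> X"
    and Hp: "\<And>f r. (f, r) \<in> H \<Longrightarrow> r \<le> p f"
    using H by (auto simp: dominated_def)
  have total: "\<exists>r. (e, r) \<in> H" if e: "e \<in> X" for e
  proof -
    have "\<exists>a. \<forall>(f, r) \<in> H. \<forall>t. r + t * a \<le> p (\<lambda>z. f z + t * e z)"
      by (rule linear_graph_slope_exists[of H p X e]) (fact lin Hp HX X(2) p e)+
    then obtain a where a: "\<And>f r t. (f, r) \<in> H \<Longrightarrow> r + t * a \<le> p (\<lambda>z. f z + t * e z)"
      by blast
    define E where "E = {((\<lambda>z. f z + t * e z), r + t * a) | f r t. (f, r) \<in> H}"
    have "H \<subseteq> E"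
    proof
      fix x assume "x \<in> H"
      then show "x \<in> E"
        unfolding E_def by (intro CollectI exI[of _ "fst x"] exI[of _ "snd x"] exI[of _ "0 :: real"]) auto
    qed
    moreover have "E \<in> dominated"
    proof -
      have "(\<lambda>z. f z + t * e z) \<in> X" if "f \<in> X" for f t using X(2)[OF that e, of 1 t] by simp
      then have "\<forall>(f, r) \<in> E. f \<in> X \<and> r \<le> p f" using a HX by (auto simp: E_def)
      moreover have "linear_graph E" unfolding E_def by (rule linear_graph_extend[OF lin])
      ultimately show ?thesis using H0 \<open>H \<subseteq> E\<close> by (auto simp: dominated_def)
    qed
    ultimately have "E = H" by (intro max)
    moreover have "((\<lambda>z. 0 + 1 * e z), 0 + 1 * a) \<in> E"
      unfolding E_def using lin
      by (intro CollectI exI[of _ "\<lambda>_. 0"] exI[of _ "0 :: real"] exI[of _ "1 :: real"]) (auto simp: linear_graph_def)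
    ultimately show ?thesis by auto
  qed
  have unique: "r = s" if "(f, r) \<in> H" "(f, s) \<in> H" for f r s
  proof (rule ccontr)
    assume "r \<noteq> s"
    \<comment> \<open>The factor that lifts the vertical vector \<open>(0, r - s)\<close> to the height \<open>p 0 + 1\<close>.\<close>
    define k where "k = (p (\<lambda>_. 0) + 1) / (r - s)"
    have "((\<lambda>z. k * f z + (-k) * f z), k * r + (-k) * s) \<in> H"
      using linear_graphD[OF lin that] .
    then have "k * r + (-k) * s \<le> p (\<lambda>z. k * f z + (-k) * f z)" by (rule Hp)
    moreover have "k * r + (-k) * s = p (\<lambda>_. 0) + 1"
    proof -
      have "k * r + (-k) * s = k * (r - s)" by (simp add: algebra_simps)
      then show ?thesis using \<open>r \<noteq> s\<close> by (simp add: k_def)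
    qed
    ultimately show False by simp
  qed
  define L where "L = (\<lambda>f. THE r. (f, r) \<in> H)"
  have L: "L f = r" if "(f, r) \<in> H" for f r
    unfolding L_def using that unique by blast
  have LH: "(f, L f) \<in> H" if "f \<in> X" for f
    using total[OF that] L by auto
  show ?thesis
  proof
    show "L (\<lambda>z. a * f z + b * g z) = a * L f + b * L g" if "f \<in> X" "g \<in> X" for f g a b
      using linear_graphD[OF lin LH[OF that(1)] LH[OF that(2)]] by (rule L)
    show "L f \<le> p f" if "f \<in> X" for f using Hp LH that by blast
    show "L f = l f" if "f \<in> V" for f using that H0 by (intro L) (auto simp: H0_def)
  qed
qed

section \<open>The conjugate of a superlinear quasi-Young's function\<close>

locale superlinear_quasi_young =
  fixes \<Phi> :: "real \<Rightarrow> ereal"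
  assumes quasi_young: "quasi_young \<Phi>"
    and superlinear: "((\<lambda>t. \<Phi> t / ereal t) \<longlongrightarrow> \<infinity>) at_top"
begin

text \<open>The conjugate is finite everywhere, as \<open>ereal_\<psi>\<close> states; the real valued version avoids extended
arithmetic under the integral.\<close>

definition \<psi> :: "real \<Rightarrow> real" where
  "\<psi> s = real_of_ereal (convex_conj (infty_ext \<Phi>) s)"

lemma \<Phi>_not_MInfty: "t \<ge> 0 \<Longrightarrow> \<Phi> t \<noteq> -\<infinity>"
  using quasi_young by (simp add: quasi_young_def)

text \<open>A Young's function vanishes at \<open>0\<close>, being an integral over a null set there.\<close>

lemma \<Phi>_0_le: "\<Phi> 0 \<le> 0"
proof -
  obtain \<phi> :: "real \<Rightarrow> ennreal" where "\<forall>t\<ge>0. max (\<Phi> t) 0 = enn2ereal (\<integral>\<^sup>+s\<in>{0..t}. \<phi> s \<partial>lborel)"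
    using quasi_young unfolding quasi_young_def young_def by blast
  then have "max (\<Phi> 0) 0 = enn2ereal (\<integral>\<^sup>+s. \<phi> s * indicator {0} s \<partial>lborel)"
    by simp
  also have "(\<integral>\<^sup>+s. \<phi> s * indicator {0} s \<partial>lborel) = (\<integral>\<^sup>+(s::real). 0 \<partial>lborel)"
    by (intro nn_integral_cong_AE AE_I'[of "{0}"]) (auto simp: indicator_def)
  finally show ?thesis by (simp add: zero_ennreal.rep_eq max_def split: if_splits)
qed

definition epigraph :: "(real \<times> real) set" where
  "epigraph = {(t, y). t \<ge> 0 \<and> \<Phi> t \<le> ereal y}"

lemma convex_epigraph: "convex epigraph"
proof (rule convexI)
  fix p q :: "real \<times> real" and u v :: real
  assume "p \<in> epigraph" "q \<in> epigraph" and uv: "0 \<le> u" "0 \<le> v" "u + v = 1"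
  then obtain t y t' y' where p: "p = (t, y)" "t \<ge> 0" "\<Phi> t \<le> ereal y"
    and q: "q = (t', y')" "t' \<ge> 0" "\<Phi> t' \<le> ereal y'"
    by (auto simp: epigraph_def)
  have "\<Phi> (u * t + v * t') \<le> ereal u * \<Phi> t + ereal v * \<Phi> t'"
    using quasi_young p(2) q(2) uv unfolding quasi_young_def ereal_convex_on_def by simp
  also have "\<dots> \<le> ereal u * ereal y + ereal v * ereal y'"
    using p q uv by (intro add_mono ereal_mult_left_mono) auto
  finally show "u *\<^sub>R p + v *\<^sub>R q \<in> epigraph"
    using p q uv by (auto simp: epigraph_def)
qed

lemma closed_epigraph: "closed epigraph"
  unfolding closed_sequential_limits
proof (intro allI impI)
  fix z :: "nat \<Rightarrow> real \<times> real" and l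
  assume "(\<forall>n. z n \<in> epigraph) \<and> z \<longlonglongrightarrow> l"
  then have z: "\<And>n. z n \<in> epigraph" and zl: "z \<longlonglongrightarrow> l" by auto
  have z': "fst (z n) \<ge> 0" "\<Phi> (fst (z n)) \<le> ereal (snd (z n))" for n
    using z[of n] by (auto simp: epigraph_def split: prod.splits)
  have l: "(\<lambda>n. fst (z n)) \<longlonglongrightarrow> fst l" "(\<lambda>n. snd (z n)) \<longlonglongrightarrow> snd l"
    using tendsto_fst[OF zl] tendsto_snd[OF zl] by auto
  have l0: "fst l \<ge> 0"
    by (rule LIMSEQ_le_const[OF l(1)]) (use z' in auto)
  have "\<Phi> (fst l) \<le> ereal (snd l)"
  proof (rule ccontr)
    assume "\<not> ?thesis"
    then have "ereal (snd l) < \<Phi> (fst l)" by simp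
    then obtain r where r: "snd l < r" "ereal r < \<Phi> (fst l)"
      using ereal_dense2 by force
    \<comment> \<open>The filter in the definition of lower semicontinuity omits the point itself, which the sequence may
      hit; there the bound holds by the choice of \<open>r\<close>.\<close>
    have "\<Phi> (fst l) \<le> Liminf (at (fst l) within {0..}) \<Phi>"
      using quasi_young l0 unfolding quasi_young_def lsc_on_def by simp
    then have "\<forall>\<^sub>F t in at (fst l) within {0..}. ereal r < \<Phi> t"
      using r(2) by (intro less_LiminfD) auto
    then have "\<forall>\<^sub>F t in nhds (fst l). t \<in> {0..} \<longrightarrow> ereal r < \<Phi> t"
      unfolding eventually_at_filter by eventually_elim (use r(2) in auto)
    from eventually_compose_filterlim[OF this l(1)]
    have "\<forall>\<^sub>F n in sequentially. ereal r < \<Phi> (fst (z n))"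
      by eventually_elim (use z' in auto)
    moreover have "\<forall>\<^sub>F n in sequentially. snd (z n) < r"
      using l(2) r(1) by (rule order_tendstoD(2))
    ultimately have "\<forall>\<^sub>F n in sequentially. False"
    proof eventually_elim
      case (elim n)
      have "ereal r < ereal (snd (z n))" using elim(1) z'(2)[of n] by (rule less_le_trans)
      then show False using elim(2) by simp
    qed
    then show False by simp
  qed
  then show "l \<in> epigraph" using l0 by (auto simp: epigraph_def split: prod.splits)
qed

text \<open>The separating normal has \<open>b \<ge> 0\<close> because the epigraph is unbounded upwards. The case \<open>b = 0\<close> is possible
if \<open>t\<^sub>0\<close> is outside the effective domain of \<open>\<Phi>\<close>.\<close>

lemma separate_epigraph:
  assumes "t\<^sub>0 \<ge> 0" "ereal r < \<Phi> t\<^sub>0"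
  obtains a b \<beta> where "b \<ge> 0" "a * t\<^sub>0 + b * r < \<beta>" "\<And>t y. t \<ge> 0 \<Longrightarrow> \<Phi> t \<le> ereal y \<Longrightarrow> \<beta> < a * t + b * y"
proof -
  have "(t\<^sub>0, r) \<notin> epigraph" using assms by (auto simp: epigraph_def)
  from separating_hyperplane_closed_point[OF convex_epigraph closed_epigraph this]
  obtain w \<beta> where w: "inner w (t\<^sub>0, r) < \<beta>" "\<forall>x\<in>epigraph. \<beta> < inner w x" by auto
  define a b where "a = fst w" and "b = snd w"
  have 1: "a * t\<^sub>0 + b * r < \<beta>" using w(1) by (simp add: inner_prod_def a_def b_def)
  have 2: "\<beta> < a * t + b * y" if "t \<ge> 0" "\<Phi> t \<le> ereal y" for t y
    using w(2) that by (auto simp: inner_prod_def a_def b_def epigraph_def)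
  have "b \<ge> 0"
  proof (rule ccontr)
    assume "\<not> b \<ge> 0"
    define y where "y = max 0 (\<beta> / b)"
    have "\<beta> < a * 0 + b * y" using \<Phi>_0_le by (intro 2) (auto simp: y_def zero_ereal_def intro: order_trans)
    moreover have "b * y \<le> b * (\<beta> / b)"
      using \<open>\<not> b \<ge> 0\<close> by (intro mult_left_mono_neg) (auto simp: y_def)
    ultimately show False using \<open>\<not> b \<ge> 0\<close> by auto
  qed
  then show ?thesis using 1 2 that by blast
qed

lemma line_below_\<Phi>I:
  assumes "b > 0" "a * t\<^sub>0 + b * r < \<beta>" "\<And>t y. t \<ge> 0 \<Longrightarrow> \<Phi> t \<le> ereal y \<Longrightarrow> \<beta> < a * t + b * y" "t \<ge> 0"
  shows "ereal (r + (- a / b) * (t - t\<^sub>0)) \<le> \<Phi> t"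
proof (cases "\<Phi> t")
  case (real y)
  have "a * t\<^sub>0 + b * r < a * t + b * y" using assms(2) assms(3)[OF \<open>t \<ge> 0\<close>, of y] real by simp
  then have "r + (- a / b) * (t - t\<^sub>0) \<le> y" using \<open>b > 0\<close> by (simp add: field_simps)
  then show ?thesis using real by simp
qed (use \<Phi>_not_MInfty[OF \<open>t \<ge> 0\<close>] in auto)

text \<open>The point just below \<open>(0, \<Phi> 0)\<close> is separated by a non-vertical line, since \<open>0\<close> is in the effective
domain.\<close>

lemma affine_minorant: "\<exists>A B. \<forall>t\<ge>0. ereal (A + B * t) \<le> \<Phi> t"
proof -
  obtain y where y: "\<Phi> 0 = ereal y" using \<Phi>_0_le \<Phi>_not_MInfty[of 0] by (cases "\<Phi> 0") auto
  obtain a b \<beta> where *: "b \<ge> 0" "a * 0 + b * (y - 1) < \<beta>"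
      "\<And>t y. t \<ge> 0 \<Longrightarrow> \<Phi> t \<le> ereal y \<Longrightarrow> \<beta> < a * t + b * y"
    by (rule separate_epigraph[of 0 "y - 1"]) (use y in auto)
  have "b > 0" using *(1,2) *(3)[of 0 y] y by (cases "b = 0") auto
  from line_below_\<Phi>I[OF this *(2,3)] show ?thesis
    by (intro exI[of _ "y - 1"] exI[of _ "- a / b"]) auto
qed

text \<open>This is the Fenchel-Moreau theorem in one dimension. If the separating line is vertical, a large
multiple of it is added to an affine minorant, which keeps it below \<open>\<Phi>\<close> on the effective domain and
raises it beyond \<open>r\<close> at \<open>t\<^sub>0\<close>.\<close>

lemma supporting_line:
  assumes t0: "t\<^sub>0 \<ge> 0" "ereal r < \<Phi> t\<^sub>0"
  shows "\<exists>s. \<forall>t\<ge>0. ereal (r + s * (t - t\<^sub>0)) \<le> \<Phi> t"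
proof -
  obtain a b \<beta> where *: "b \<ge> 0" "a * t\<^sub>0 + b * r < \<beta>"
      "\<And>t y. t \<ge> 0 \<Longrightarrow> \<Phi> t \<le> ereal y \<Longrightarrow> \<beta> < a * t + b * y"
    by (rule separate_epigraph[OF t0]) (rule that)
  show ?thesis
  proof (cases "b = 0")
    case False
    then have "b > 0" using *(1) by simp
    from line_below_\<Phi>I[OF this *(2,3)] show ?thesis by blast
  next
    case True
    obtain A B where AB: "\<And>t. t \<ge> 0 \<Longrightarrow> ereal (A + B * t) \<le> \<Phi> t" using affine_minorant by auto
    define d where "d = \<beta> - a * t\<^sub>0"
    \<comment> \<open>The multiple that closes the gap between \<open>r\<close> and the affine minorant at \<open>t\<^sub>0\<close>.\<close>
    define k where "k = \<bar>r - A - B * t\<^sub>0\<bar> / d"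
    have d: "d > 0" using *(2) True by (simp add: d_def)
    have k: "k \<ge> 0" "k * d = \<bar>r - A - B * t\<^sub>0\<bar>" using d by (auto simp: k_def)
    have "ereal (r + (B - k * a) * (t - t\<^sub>0)) \<le> \<Phi> t" if t: "t \<ge> 0" for t
    proof (cases "\<Phi> t")
      case (real y)
      then have "\<beta> < a * t" using *(3)[OF t, of y] True by simp
      then have "k * (a * t - \<beta>) \<ge> 0" using k(1) by simp
      then have "r + (B - k * a) * (t - t\<^sub>0) \<le> A + B * t"
        using k(2) unfolding d_def by (simp add: algebra_simps)
      then show ?thesis using AB[OF t] by (meson ereal_less_eq(3) order_trans)
    qed (use \<Phi>_not_MInfty[OF t] in auto)
    then show ?thesis by blast
  qed
qed

text \<open>Testing with \<open>t = 0\<close> gives the lower bound. For the upper bound, superlinearity makes \<open>s * t - \<Phi> t\<close>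
negative for large \<open>t\<close>, and on the remaining bounded interval the affine minorant of \<open>\<Phi>\<close> applies.\<close>

lemma conj_bounds: "- \<Phi> 0 \<le> convex_conj (infty_ext \<Phi>) s" "convex_conj (infty_ext \<Phi>) s < \<infinity>"
proof -
  show "- \<Phi> 0 \<le> convex_conj (infty_ext \<Phi>) s"
    unfolding convex_conj_def by (rule SUP_upper2[of 0]) (auto simp: infty_ext_def minus_ereal_def zero_ereal_def[symmetric])
  obtain A B where AB: "\<And>t. t \<ge> 0 \<Longrightarrow> ereal (A + B * t) \<le> \<Phi> t" using affine_minorant by auto
  have "\<forall>\<^sub>F t in at_top. ereal s < \<Phi> t / ereal t"
    using superlinear by (simp add: tendsto_PInfty)
  then obtain T where T: "\<And>t. t \<ge> T \<Longrightarrow> ereal s < \<Phi> t / ereal t"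
    by (auto simp: eventually_at_top_linorder)
  define K where "K = \<bar>s - B\<bar> * \<bar>T\<bar> + \<bar>A\<bar>"
  have "ereal (s * t) - infty_ext \<Phi> t \<le> ereal K" for t
  proof (cases "t \<ge> 0")
    case True
    show ?thesis
    proof (cases "\<Phi> t")
      case (real y)
      have K0: "K \<ge> 0" by (simp add: K_def)
      have AB': "A + B * t \<le> y" using AB[OF True] real by simp
      have "s * t - y \<le> K"
      proof (cases "t \<ge> T \<and> t > 0")
        case True
        then have "s < y / t" using T[of t] real by simp
        then have "s * t < y" using True by (simp add: field_simps)
        then show ?thesis using K0 by linarith
      next
        case False
        then have "\<bar>t\<bar> \<le> \<bar>T\<bar>" using \<open>t \<ge> 0\<close> by auto
        have "s * t - y \<le> (s - B) * t - A" using AB' by (simp add: algebra_simps)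
        also have "(s - B) * t \<le> \<bar>s - B\<bar> * \<bar>T\<bar>"
          using mult_left_mono[OF \<open>\<bar>t\<bar> \<le> \<bar>T\<bar>\<close>, of "\<bar>s - B\<bar>"] abs_ge_self[of "(s - B) * t"]
          by (simp add: abs_mult)
        finally show ?thesis by (simp add: K_def)
      qed
      then show ?thesis using real True by (simp add: infty_ext_def)
    qed (use \<Phi>_not_MInfty[OF True] True in \<open>auto simp: infty_ext_def\<close>)
  qed (auto simp: infty_ext_def)
  then have "convex_conj (infty_ext \<Phi>) s \<le> ereal K"
    unfolding convex_conj_def by (intro SUP_least)
  then show "convex_conj (infty_ext \<Phi>) s < \<infinity>" by (rule le_less_trans) simp
qed

lemma ereal_\<psi>: "convex_conj (infty_ext \<Phi>) s = ereal (\<psi> s)"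
proof -
  have "0 \<le> - \<Phi> 0" using \<Phi>_0_le by (simp add: ereal_0_le_uminus_iff)
  then have "0 \<le> convex_conj (infty_ext \<Phi>) s" using conj_bounds(1)[of s] by (rule order_trans)
  then show ?thesis using conj_bounds(2)[of s] by (cases "convex_conj (infty_ext \<Phi>) s") (auto simp: \<psi>_def)
qed

lemma \<psi>_nonneg: "\<psi> s \<ge> 0"
proof -
  have "0 \<le> - \<Phi> 0" using \<Phi>_0_le by (simp add: ereal_0_le_uminus_iff)
  also have "\<dots> \<le> ereal (\<psi> s)" using conj_bounds(1)[of s] by (simp add: ereal_\<psi>)
  finally show ?thesis by simp
qed

lemma young_inequality: "ereal (s * t - \<psi> s) \<le> infty_ext \<Phi> t"
proof -
  have "ereal (s * t) - infty_ext \<Phi> t \<le> ereal (\<psi> s)"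
    unfolding ereal_\<psi>[symmetric] convex_conj_def by (rule SUP_upper) simp
  then show ?thesis by (cases "infty_ext \<Phi> t") auto
qed

text \<open>Only points of the effective domain, where \<open>\<Phi>\<close> is a real number, matter for the supremum.\<close>

lemma \<psi>_leI:
  assumes "\<And>t y. t \<ge> 0 \<Longrightarrow> \<Phi> t = ereal y \<Longrightarrow> s * t - y \<le> k"
  shows "\<psi> s \<le> k"
proof -
  have "ereal (s * t) - infty_ext \<Phi> t \<le> ereal k" for t
    using assms[of t] \<Phi>_not_MInfty[of t] by (cases "infty_ext \<Phi> t") (auto simp: infty_ext_def split: if_splits)
  then have "ereal (\<psi> s) \<le> ereal k"
    unfolding ereal_\<psi>[symmetric] convex_conj_def by (intro SUP_least)
  then show ?thesis by simp
qed

lemma \<psi>_ge: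
  assumes "t \<ge> 0" "\<Phi> t = ereal y" shows "s * t - y \<le> \<psi> s"
  using young_inequality[of s t] assms by (simp add: infty_ext_def)

text \<open>The extension of \<open>\<Phi>\<close> is infinite on the negative axis, so \<open>\<psi>\<close> is a supremum of increasing affine functions.\<close>

lemma mono_\<psi>: "s \<le> s' \<Longrightarrow> \<psi> s \<le> \<psi> s'"
proof (rule \<psi>_leI)
  fix t y assume "s \<le> s'" and t: "t \<ge> 0" "\<Phi> t = ereal y"
  have "s * t - y \<le> s' * t - y" using \<open>s \<le> s'\<close> t(1) by (simp add: mult_right_mono)
  also have "\<dots> \<le> \<psi> s'" using t by (rule \<psi>_ge)
  finally show "s * t - y \<le> \<psi> s'" .
qed

lemma convex_\<psi>: "convex_on UNIV \<psi>"
proof (rule convex_onI)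
  fix u :: real and s s' :: real assume u: "0 < u" "u < 1"
  show "\<psi> ((1 - u) *\<^sub>R s + u *\<^sub>R s') \<le> (1 - u) * \<psi> s + u * \<psi> s'"
  proof (rule \<psi>_leI)
    fix t y assume t: "t \<ge> 0" "\<Phi> t = ereal y"
    have "((1 - u) *\<^sub>R s + u *\<^sub>R s') * t - y = (1 - u) * (s * t - y) + u * (s' * t - y)"
      by (simp add: algebra_simps)
    also have "\<dots> \<le> (1 - u) * \<psi> s + u * \<psi> s'"
      using u t by (intro add_mono mult_left_mono \<psi>_ge) auto
    finally show "((1 - u) *\<^sub>R s + u *\<^sub>R s') * t - y \<le> (1 - u) * \<psi> s + u * \<psi> s'" .
  qed
qed simp

lemma continuous_\<psi>: "continuous_on S \<psi>"
  using convex_on_continuous[OF open_UNIV convex_\<psi>] continuous_on_subset by blast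

lemma measurable_\<psi> [measurable]: "\<psi> \<in> borel_measurable borel"
  using continuous_\<psi> by (rule borel_measurable_continuous_onI)

text \<open>By continuity of \<open>\<psi>\<close>, a slope that beats \<open>r\<close> can be replaced by a nearby rational one. The countable
supremum provides measurability and a monotone sequence of maxima over finitely many slopes.\<close>

lemma biconjugate_rat: "infty_ext \<Phi> t = (SUP q. ereal (real_of_rat q * t - \<psi> (real_of_rat q)))" if t: "t \<ge> 0"
proof (rule antisym)
  show "(SUP q. ereal (real_of_rat q * t - \<psi> (real_of_rat q))) \<le> infty_ext \<Phi> t"
    by (intro SUP_least young_inequality)
  show "infty_ext \<Phi> t \<le> (SUP q. ereal (real_of_rat q * t - \<psi> (real_of_rat q)))"
  proof (rule dense_le)
    fix x assume "x < infty_ext \<Phi> t"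
    then have x: "x < \<Phi> t" using t by (simp add: infty_ext_def)
    show "x \<le> (SUP q. ereal (real_of_rat q * t - \<psi> (real_of_rat q)))"
    proof (cases x)
      case (real r)
      obtain r' where r': "r < r'" "ereal r' < \<Phi> t" using ereal_dense2[OF x] real by auto
      obtain s where s: "\<And>u. u \<ge> 0 \<Longrightarrow> ereal (r' + s * (u - t)) \<le> \<Phi> u"
        using supporting_line[OF t r'(2)] by auto
      have "\<psi> s \<le> s * t - r'"
      proof (rule \<psi>_leI)
        fix u y assume "u \<ge> 0" "\<Phi> u = ereal y"
        then show "s * u - y \<le> s * t - r'" using s[of u] by (simp add: algebra_simps)
      qed
      then have rs: "r < s * t - \<psi> s" using r' by simp
      have "((\<lambda>s. s * t - \<psi> s) \<longlongrightarrow> s * t - \<psi> s) (at s)"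
        using continuous_\<psi>[of UNIV] by (intro tendsto_intros) (auto simp: continuous_on_def)
      then have "\<forall>\<^sub>F s' in at s. r < s' * t - \<psi> s'" using rs by (rule order_tendstoD)
      then obtain d where d: "d > 0" "\<And>s'. s' \<noteq> s \<Longrightarrow> dist s' s < d \<Longrightarrow> r < s' * t - \<psi> s'"
        by (auto simp: eventually_at)
      obtain q where q: "s < real_of_rat q" "real_of_rat q < s + d"
        using of_rat_dense[of s "s + d"] d(1) by auto
      have "r < real_of_rat q * t - \<psi> (real_of_rat q)"
        using q by (intro d(2)) (auto simp: dist_real_def)
      then show ?thesis
        unfolding real by (intro SUP_upper2[of q]) auto
    qed (use x in auto)
  qed
qed

end

section \<open>Integrals of extended real valued functions\<close>

lemma ereal_integral_real:
  assumes f: "integrable M f"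
  shows "ereal_integral M (\<lambda>x. ereal (f x)) = ereal (\<integral>x. f x \<partial>M)"
proof -
  have part: "enn2ereal (\<integral>\<^sup>+x. ennreal (g x) \<partial>M) = ereal (\<integral>x. max 0 (g x) \<partial>M)"
    if "integrable M g" for g
  proof -
    have "(\<integral>\<^sup>+x. ennreal (g x) \<partial>M) = (\<integral>\<^sup>+x. ennreal (max 0 (g x)) \<partial>M)"
      by (intro nn_integral_cong) (auto simp: max_def ennreal_neg)
    also have "\<dots> = ennreal (\<integral>x. max 0 (g x) \<partial>M)"
      using that by (intro nn_integral_eq_integral) auto
    finally show ?thesis by (simp add: enn2ereal_ennreal)
  qed
  have "ereal_integral M (\<lambda>x. ereal (f x)) = ereal ((\<integral>x. max 0 (f x) \<partial>M) - (\<integral>x. max 0 (- f x) \<partial>M))"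
    using part[of f] part[of "\<lambda>x. - f x"] f by (simp add: ereal_integral_def)
  also have "(\<integral>x. max 0 (f x) \<partial>M) - (\<integral>x. max 0 (- f x) \<partial>M) = (\<integral>x. max 0 (f x) - max 0 (- f x) \<partial>M)"
    using f by (intro Bochner_Integration.integral_diff[symmetric]) auto
  also have "\<dots> = (\<integral>x. f x \<partial>M)"
    by (intro Bochner_Integration.integral_cong) auto
  finally show ?thesis .
qed

lemma ereal_integral_ge:
  assumes u: "integrable M u" and uv: "\<And>x. x \<in> space M \<Longrightarrow> ereal (u x) \<le> v x"
  shows "ereal (\<integral>x. u x \<partial>M) \<le> ereal_integral M v"
proof -
  have "ereal (\<integral>x. u x \<partial>M) = ereal_integral M (\<lambda>x. ereal (u x))"
    using ereal_integral_real[OF u] by simp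
  also have "\<dots> \<le> ereal_integral M v"
    unfolding ereal_integral_def
  proof (intro ereal_minus_mono)
    show "enn2ereal (\<integral>\<^sup>+x. e2ennreal (ereal (u x)) \<partial>M) \<le> enn2ereal (\<integral>\<^sup>+x. e2ennreal (v x) \<partial>M)"
      unfolding less_eq_ennreal.rep_eq[symmetric] using uv by (intro nn_integral_mono e2ennreal_mono)
    have "- v x \<le> - ereal (u x)" if "x \<in> space M" for x
      unfolding ereal_minus_le_minus using uv[OF that] .
    then show "enn2ereal (\<integral>\<^sup>+x. e2ennreal (- v x) \<partial>M) \<le> enn2ereal (\<integral>\<^sup>+x. e2ennreal (- ereal (u x)) \<partial>M)"
      unfolding less_eq_ennreal.rep_eq[symmetric] by (intro nn_integral_mono e2ennreal_mono)
  qed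
  finally show ?thesis .
qed

text \<open>Shifting by a constant turns an integral of a function that is bounded below into an integral of a
nonnegative function, for which monotone convergence is available, also when the value is infinite.\<close>

lemma (in finite_measure) ereal_integral_bounded_below:
  assumes v: "v \<in> borel_measurable M" "\<And>x. x \<in> space M \<Longrightarrow> ereal (- C) \<le> v x" and C: "C \<ge> 0"
  shows "ereal_integral M v = enn2ereal (\<integral>\<^sup>+x. e2ennreal (v x + ereal C) \<partial>M) - ereal (C * measure M (space M))"
proof -
  have [measurable]: "v \<in> borel_measurable M" by fact
  let ?m = "ennreal (C * measure M (space M))"
  have pt: "e2ennreal (v x + ereal C) + e2ennreal (- v x) = e2ennreal (v x) + ennreal C"
    if "x \<in> space M" for x
  proof (cases "v x")
    case (real r)
    then have "- C \<le> r" using v(2)[OF that] by simp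
    then show ?thesis using real C
      by (cases "r \<ge> 0") (auto simp: ennreal_neg ennreal_plus[symmetric] simp del: ennreal_plus)
  qed (use v(2)[OF that] in auto)
  have "(\<integral>\<^sup>+x. e2ennreal (v x + ereal C) \<partial>M) + (\<integral>\<^sup>+x. e2ennreal (- v x) \<partial>M)
      = (\<integral>\<^sup>+x. e2ennreal (v x) \<partial>M) + (\<integral>\<^sup>+x. ennreal C \<partial>M)"
    using pt by (subst (1 2) nn_integral_add[symmetric]) (auto intro!: nn_integral_cong)
  also have "(\<integral>\<^sup>+x. ennreal C \<partial>M) = ?m"
    using C by (simp add: emeasure_eq_measure ennreal_mult)
  finally have eq: "(\<integral>\<^sup>+x. e2ennreal (v x + ereal C) \<partial>M) + (\<integral>\<^sup>+x. e2ennreal (- v x) \<partial>M)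
      = (\<integral>\<^sup>+x. e2ennreal (v x) \<partial>M) + ?m" .
  have "(\<integral>\<^sup>+x. e2ennreal (- v x) \<partial>M) \<le> (\<integral>\<^sup>+x. ennreal C \<partial>M)"
  proof (intro nn_integral_mono)
    fix x assume "x \<in> space M"
    then have "- v x \<le> ereal C" using v(2) by (simp add: ereal_uminus_le_reorder)
    then show "e2ennreal (- v x) \<le> ennreal C" using e2ennreal_mono by fastforce
  qed
  also have "\<dots> < \<infinity>"
    using C by (simp add: emeasure_eq_measure ennreal_mult_less_top)
  finally have fin: "(\<integral>\<^sup>+x. e2ennreal (- v x) \<partial>M) < \<infinity>" .
  obtain n where n: "(\<integral>\<^sup>+x. e2ennreal (- v x) \<partial>M) = ennreal n" "n \<ge> 0"
    using fin by (cases "(\<integral>\<^sup>+x. e2ennreal (- v x) \<partial>M)") auto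
  show ?thesis
  proof (cases "(\<integral>\<^sup>+x. e2ennreal (v x) \<partial>M)")
    case (real a)
 have "(\<integral>\<^sup>+x. e2ennreal (v x + ereal C) \<partial>M) \<noteq> top"
    proof
      assume "(\<integral>\<^sup>+x. e2ennreal (v x + ereal C) \<partial>M) = top"
      then have "top = ennreal a + ?m" using eq real by simp
      then show False by (metis ennreal_add_eq_top ennreal_neq_top)
    qed
    then obtain b where b: "(\<integral>\<^sup>+x. e2ennreal (v x + ereal C) \<partial>M) = ennreal b" "b \<ge> 0"
      by (cases "(\<integral>\<^sup>+x. e2ennreal (v x + ereal C) \<partial>M)") auto
    have "ennreal (b + n) = ennreal (a + C * measure M (space M))"
      using eq b n real C by simp
    then have "b + n = a + C * measure M (space M)"
      using b n real C by (subst (asm) ennreal_inj) auto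
    then show ?thesis using b n real by (simp add: ereal_integral_def enn2ereal_ennreal)
  next
    case top
    then have "(\<integral>\<^sup>+x. e2ennreal (v x + ereal C) \<partial>M) = \<infinity>" using eq n by (cases "(\<integral>\<^sup>+x. e2ennreal (v x + ereal C) \<partial>M)") auto
    then show ?thesis using top n by (simp add: ereal_integral_def enn2ereal_ennreal)
  qed
qed

section \<open>The energy of a bounded Borel function\<close>

locale transport_energy = superlinear_quasi_young \<Phi>
  for \<Phi> :: "real \<Rightarrow> ereal" +
  fixes \<Omega> :: "'z::metric_space set" and lam :: "'z measure" and c :: "'z \<Rightarrow> real" and \<gamma> :: real
  assumes compact: "compact \<Omega>" and lam: "lam \<in> finite_radon \<Omega>"
    and continuous_c: "continuous_on \<Omega> c" and \<gamma>: "\<gamma> > 0"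
begin

text \<open>The arguments of the energy are functions on the whole type, of which only the values on \<open>\<Omega>\<close> matter.\<close>

abbreviation (input) "\<B> \<equiv> bounded_measurable (borel_on \<Omega>)"

lemma space_borel_on_\<Omega>: "space (borel_on \<Omega>) = \<Omega>"
  by (simp add: space_restrict_space)

lemmas sets_lam = finite_radonD(2)[OF lam]
  and space_lam = finite_radonD(3)[OF lam]
  and \<B>_lam = finite_radonD(4)[OF lam]

sublocale finite_measure lam by (rule finite_radonD(1)[OF lam])

lemma \<B>_bound: "f \<in> \<B> \<Longrightarrow> \<exists>B. \<forall>z\<in>\<Omega>. \<bar>f z\<bar> \<le> B"
  by (auto simp: bounded_measurable_def space_restrict_space)

lemma c_\<B>: "c \<in> \<B>"
  by (rule continuous_bounded_measurable[OF compact continuous_c])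

lemma \<B>_I: "f \<in> borel_measurable lam \<Longrightarrow> (\<And>z. z \<in> \<Omega> \<Longrightarrow> \<bar>f z\<bar> \<le> B) \<Longrightarrow> f \<in> \<B>"
  unfolding \<B>_lam[symmetric] by (rule bounded_measurableI) (auto simp: space_lam)

lemma \<B>_measurable_lam: "f \<in> \<B> \<Longrightarrow> f \<in> borel_measurable lam"
  unfolding \<B>_lam[symmetric] by (rule bounded_measurable_measurable)

lemma \<B>_arg: "f \<in> \<B> \<Longrightarrow> (\<lambda>z. (f z - c z) / \<gamma>) \<in> \<B>"
  using bounded_measurable_lincomb[OF _ c_\<B>, of f "1 / \<gamma>" "- 1 / \<gamma>"] by (simp add: diff_divide_distrib)

lemma \<psi>_\<B>: "f \<in> \<B> \<Longrightarrow> (\<lambda>z. \<psi> (f z)) \<in> \<B>"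
proof -
  assume f: "f \<in> \<B>"
  then obtain B where B: "\<And>z. z \<in> \<Omega> \<Longrightarrow> \<bar>f z\<bar> \<le> B" using \<B>_bound by blast
  have "\<bar>\<psi> (f z)\<bar> \<le> \<psi> B" if "z \<in> \<Omega>" for z
    using \<psi>_nonneg[of "f z"] mono_\<psi>[of "f z" B] B[OF that] by auto
  then show ?thesis using \<B>_measurable_lam[OF f] by (intro \<B>_I) auto
qed

lemma \<B>_integrable: "f \<in> \<B> \<Longrightarrow> integrable lam f"
  unfolding \<B>_lam[symmetric] by (rule bounded_measurable_integrable)

text \<open>This is \<open>Pstar_G\<close> as a real number, for all bounded Borel functions instead of continuous ones only.\<close>

definition energy :: "('z \<Rightarrow> real) \<Rightarrow> real" where
  "energy f = \<gamma> * (\<integral>z. \<psi> ((f z - c z) / \<gamma>) \<partial>lam)"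

lemma integrable_energy: "f \<in> \<B> \<Longrightarrow> integrable lam (\<lambda>z. \<psi> ((f z - c z) / \<gamma>))"
  by (intro \<B>_integrable \<psi>_\<B> \<B>_arg)

lemma Pstar_G_eq_energy:
  assumes "f \<in> \<B>" shows "Pstar_G c \<gamma> \<Phi> lam f = ereal (energy f)"
  using ereal_integral_real[OF integrable_energy[OF assms]]
  by (simp add: Pstar_G_def energy_def ereal_\<psi>)

lemma energy_mono:
  assumes "f \<in> \<B>" "g \<in> \<B>" "\<And>z. z \<in> \<Omega> \<Longrightarrow> f z \<le> g z"
  shows "energy f \<le> energy g"
  unfolding energy_def using assms \<gamma>
  by (intro mult_left_mono integral_mono integrable_energy mono_\<psi>)
    (auto simp: space_lam divide_right_mono)

lemma energy_AE_cong:
  assumes "f \<in> \<B>" "g \<in> \<B>" "AE z in lam. f z = g z"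
  shows "energy f = energy g"
proof -
  have "(\<integral>z. \<psi> ((f z - c z) / \<gamma>) \<partial>lam) = (\<integral>z. \<psi> ((g z - c z) / \<gamma>) \<partial>lam)"
    using assms integrable_energy[THEN borel_measurable_integrable]
    by (intro integral_cong_AE) auto
  then show ?thesis by (simp add: energy_def)
qed

lemma energy_convex:
  assumes f: "f \<in> \<B>" and g: "g \<in> \<B>" and u: "0 \<le> u" "u \<le> 1"
  shows "energy (\<lambda>z. (1 - u) * f z + u * g z) \<le> (1 - u) * energy f + u * energy g"
proof -
  have "\<psi> (((1 - u) * f z + u * g z - c z) / \<gamma>)
      \<le> (1 - u) * \<psi> ((f z - c z) / \<gamma>) + u * \<psi> ((g z - c z) / \<gamma>)" for z
  proof -
    have "((1 - u) * f z + u * g z - c z) / \<gamma> =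
        (1 - u) *\<^sub>R ((f z - c z) / \<gamma>) + u *\<^sub>R ((g z - c z) / \<gamma>)"
      using \<gamma> by (simp add: field_simps)
    then show ?thesis by (simp only:) (rule convex_onD[OF convex_\<psi> u], auto)
  qed
  then have "(\<integral>z. \<psi> (((1 - u) * f z + u * g z - c z) / \<gamma>) \<partial>lam)
      \<le> (\<integral>z. (1 - u) * \<psi> ((f z - c z) / \<gamma>) + u * \<psi> ((g z - c z) / \<gamma>) \<partial>lam)"
    using f g by (intro integral_mono integrable_energy bounded_measurable_lincomb
        Bochner_Integration.integrable_add integrable_mult_right) auto
  also have "\<dots> = (1 - u) * (\<integral>z. \<psi> ((f z - c z) / \<gamma>) \<partial>lam) + u * (\<integral>z. \<psi> ((g z - c z) / \<gamma>) \<partial>lam)"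
    using f g integrable_energy by simp
  finally have "energy (\<lambda>z. (1 - u) * f z + u * g z) \<le>
      \<gamma> * ((1 - u) * (\<integral>z. \<psi> ((f z - c z) / \<gamma>) \<partial>lam) + u * (\<integral>z. \<psi> ((g z - c z) / \<gamma>) \<partial>lam))"
    unfolding energy_def using \<gamma> by (intro mult_left_mono) auto
  then show ?thesis by (simp add: energy_def algebra_simps)
qed

text \<open>The integrands converge by continuity of \<open>\<psi>\<close>; monotonicity of \<open>\<psi>\<close> bounds them uniformly.\<close>

lemma energy_bounded_convergence:
  assumes F: "\<And>n. F n \<in> \<B>" "\<And>n z. z \<in> \<Omega> \<Longrightarrow> \<bar>F n z\<bar> \<le> B"
    and lim: "\<And>z. z \<in> \<Omega> \<Longrightarrow> (\<lambda>n. F n z) \<longlonglongrightarrow> f z"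
  shows "(\<lambda>n. energy (F n)) \<longlonglongrightarrow> energy f"
proof -
  obtain C where C: "\<And>z. z \<in> \<Omega> \<Longrightarrow> \<bar>c z\<bar> \<le> C" using \<B>_bound[OF c_\<B>] by blast
  have "(\<lambda>n. \<integral>z. \<psi> ((F n z - c z) / \<gamma>) \<partial>lam) \<longlonglongrightarrow> (\<integral>z. \<psi> ((f z - c z) / \<gamma>) \<partial>lam)"
  proof (rule bounded_convergence)
    show "(\<lambda>z. \<psi> ((F n z - c z) / \<gamma>)) \<in> borel_measurable lam" for n
      using integrable_energy[OF F(1)] by (rule borel_measurable_integrable)
    show "\<bar>\<psi> ((F n z - c z) / \<gamma>)\<bar> \<le> \<psi> ((B + C) / \<gamma>)" if "z \<in> space lam" for n z
    proof -
      have "F n z - c z \<le> B + C" using F(2)[of z n] C[of z] that by (simp add: space_lam)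
      then have "\<psi> ((F n z - c z) / \<gamma>) \<le> \<psi> ((B + C) / \<gamma>)"
        using \<gamma> by (intro mono_\<psi> divide_right_mono) auto
      then show ?thesis using \<psi>_nonneg by simp
    qed
    show "(\<lambda>n. \<psi> ((F n z - c z) / \<gamma>)) \<longlonglongrightarrow> \<psi> ((f z - c z) / \<gamma>)" if "z \<in> space lam" for z
      using that \<gamma> lim[of z]
      by (intro continuous_on_tendsto_compose[OF continuous_\<psi>[of UNIV]] tendsto_intros) (auto simp: space_lam)
  qed
  then show ?thesis unfolding energy_def by (rule tendsto_mult_left)
qed

end

section \<open>Functionals dominated by the energy are measures\<close>

lemma bounded_multiples_imp_nonpos:
  assumes "\<And>k :: real. k > 0 \<Longrightarrow> k * x \<le> E" shows "x \<le> (0::real)"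
proof (rule ccontr)
  assume "\<not> x \<le> 0"
  then have "((\<bar>E\<bar> + 1) / x) * x \<le> E" by (intro assms) auto
  then show False using \<open>\<not> x \<le> 0\<close> by simp
qed

text \<open>Two such functionals occur below: the difference of the integrals with respect to the two parts of a
signed measure at which the dual objective is finite, and the functional that the Hahn-Banach theorem
provides.\<close>

locale energy_dominated_functional = transport_energy \<Phi> \<Omega> lam c \<gamma>
  for \<Phi> and \<Omega> :: "'z::metric_space set" and lam c \<gamma> +
  fixes L :: "('z \<Rightarrow> real) \<Rightarrow> real" and K :: real
  assumes linear: "\<And>f g a b. f \<in> \<B> \<Longrightarrow> g \<in> \<B> \<Longrightarrow> L (\<lambda>z. a * f z + b * g z) = a * L f + b * L g"
    and dominated: "\<And>f. f \<in> \<B> \<Longrightarrow> L f \<le> K + energy f"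
begin

lemma L_zero: "L (\<lambda>_. 0) = 0"
  using linear[OF bounded_measurable_const bounded_measurable_const, of 0 0 0 0] by simp

lemma L_scale: "f \<in> \<B> \<Longrightarrow> L (\<lambda>z. a * f z) = a * L f"
  using linear[of f f a 0] by simp

lemma scale_\<B>: "f \<in> \<B> \<Longrightarrow> (\<lambda>z. a * f z) \<in> \<B>"
  using bounded_measurable_lincomb[of f _ f a 0] by simp

text \<open>For each fixed \<open>k\<close> the functions \<open>k * F n\<close> also tend to \<open>0\<close> boundedly, so \<open>k * L (F n)\<close> is eventually below
\<open>K + energy 0 + 1\<close>, and the same holds for \<open>- k\<close>. Since this bound does not depend on \<open>k\<close>, it forces
\<open>L (F n)\<close> to \<open>0\<close>.\<close>

lemma L_null_sequence:
  assumes F: "\<And>n. F n \<in> \<B>" "\<And>n z. z \<in> \<Omega> \<Longrightarrow> \<bar>F n z\<bar> \<le> B"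
    and lim: "\<And>z. z \<in> \<Omega> \<Longrightarrow> (\<lambda>n. F n z) \<longlonglongrightarrow> 0"
  shows "(\<lambda>n. L (F n)) \<longlonglongrightarrow> 0"
proof (rule LIMSEQ_I)
  fix e :: real assume e: "e > 0"
  define E where "E = K + energy (\<lambda>_. 0) + 1"
  have "E \<ge> 1" using dominated[OF bounded_measurable_const, of 0] by (simp add: L_zero E_def)
  define k where "k = E / e"
  have k: "k > 0" using \<open>E \<ge> 1\<close> e by (simp add: k_def)
  have ev: "\<forall>\<^sub>F n in sequentially. a * L (F n) < E" for a
  proof -
    have "(\<lambda>n. energy (\<lambda>z. a * F n z)) \<longlonglongrightarrow> energy (\<lambda>_. 0)"
    proof (rule energy_bounded_convergence)
      show "\<bar>a * F n z\<bar> \<le> \<bar>a\<bar> * B" if "z \<in> \<Omega>" for n z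
        using F(2)[OF that] by (auto simp: abs_mult intro: mult_left_mono)
      show "(\<lambda>n. a * F n z) \<longlonglongrightarrow> 0" if "z \<in> \<Omega>" for z
        using tendsto_mult_left[OF lim[OF that], of a] by simp
    qed (rule scale_\<B>[OF F(1)])
    then have "\<forall>\<^sub>F n in sequentially. energy (\<lambda>z. a * F n z) < energy (\<lambda>_. 0) + 1"
      by (rule order_tendstoD) simp
    then show ?thesis
    proof eventually_elim
      case (elim n)
      have "a * L (F n) \<le> K + energy (\<lambda>z. a * F n z)"
        using dominated[OF scale_\<B>[OF F(1)]] L_scale[OF F(1)] by simp
      then show ?case using elim by (simp add: E_def)
    qed
  qed
  have "\<forall>\<^sub>F n in sequentially. norm (L (F n) - 0) < e"
    using ev[of k] ev[of "-k"]
  proof eventually_elim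
    case (elim n)
    then have "k * \<bar>L (F n)\<bar> < k * e"
      using k e by (auto simp: abs_if k_def)
    then show ?case using k by simp
  qed
  then show "\<exists>no. \<forall>n\<ge>no. norm (L (F n) - 0) < e"
    by (simp add: eventually_sequentially)
qed

lemma L_bounded_convergence:
  assumes F: "\<And>n. F n \<in> \<B>" "\<And>n z. z \<in> \<Omega> \<Longrightarrow> \<bar>F n z\<bar> \<le> B"
    and lim: "\<And>z. z \<in> \<Omega> \<Longrightarrow> (\<lambda>n. F n z) \<longlonglongrightarrow> f z" and f: "f \<in> \<B>"
  shows "(\<lambda>n. L (F n)) \<longlonglongrightarrow> L f"
proof -
  obtain C where C: "\<And>z. z \<in> \<Omega> \<Longrightarrow> \<bar>f z\<bar> \<le> C" using \<B>_bound[OF f] by blast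
  have "(\<lambda>n. L (\<lambda>z. 1 * F n z + (-1) * f z)) \<longlonglongrightarrow> 0"
  proof (rule L_null_sequence)
    show "(\<lambda>z. 1 * F n z + (-1) * f z) \<in> \<B>" for n using F(1) f by (rule bounded_measurable_lincomb)
    show "\<bar>1 * F n z + (-1) * f z\<bar> \<le> B + C" if "z \<in> \<Omega>" for n z
      using F(2)[OF that, of n] C[OF that] by simp
    show "(\<lambda>n. 1 * F n z + (-1) * f z) \<longlonglongrightarrow> 0" if "z \<in> \<Omega>" for z
      using tendsto_diff[OF lim[OF that] tendsto_const[of "f z"]] by simp
  qed
  moreover have "L (\<lambda>z. 1 * F n z + (-1) * f z) = L (F n) - L f" for n
    using linear[OF F(1)[of n] f, of 1 "-1"] by simp
  ultimately have "(\<lambda>n. L (F n) - L f) \<longlonglongrightarrow> 0" by simp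
  then show ?thesis by (rule LIM_zero_cancel)
qed

lemma indicator_\<B>: "A \<in> sets (borel_on \<Omega>) \<Longrightarrow> (indicator A :: 'z \<Rightarrow> real) \<in> \<B>"
  by (rule bounded_measurable_indicator)

text \<open>Since \<open>\<psi>\<close> is increasing, the energy of \<open>- k * indicator A\<close> is at most that of \<open>0\<close> for every \<open>k > 0\<close>.\<close>

lemma L_indicator_nonneg:
  assumes A: "A \<in> sets (borel_on \<Omega>)" shows "0 \<le> L (indicator A)"
proof -
  have "- L (indicator A) \<le> 0"
  proof (rule bounded_multiples_imp_nonpos)
    fix k :: real assume "k > 0"
    have "(- k) * L (indicator A) \<le> K + energy (\<lambda>z. (- k) * indicator A z)"
      using dominated[OF scale_\<B>[OF indicator_\<B>[OF A]], of "- k"]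
      unfolding L_scale[OF indicator_\<B>[OF A]] .
    also have "\<dots> \<le> K + energy (\<lambda>_. 0)"
      using \<open>k > 0\<close> by (intro add_left_mono energy_mono scale_\<B> indicator_\<B> A bounded_measurable_const) auto
    finally show "k * - L (indicator A) \<le> K + energy (\<lambda>_. 0)" by simp
  qed
  then show ?thesis by simp
qed

text \<open>On a null set the energy does not see arbitrarily large multiples of the indicator.\<close>

lemma L_indicator_null:
  assumes A: "A \<in> null_sets lam" shows "L (indicator A) = 0"
proof (rule antisym)
  have A': "A \<in> sets (borel_on \<Omega>)" using A sets_lam by auto
  show "L (indicator A) \<le> 0"
  proof (rule bounded_multiples_imp_nonpos)
    fix k :: real assume "k > 0"
    have "k * L (indicator A) \<le> K + energy (\<lambda>z. k * indicator A z)"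
      using dominated[OF scale_\<B>[OF indicator_\<B>[OF A']], of k] L_scale[OF indicator_\<B>[OF A']] by simp
    also have "energy (\<lambda>z. k * indicator A z) = energy (\<lambda>_. 0)"
    proof (rule energy_AE_cong)
      show "AE z in lam. k * indicator A z = 0"
        using AE_not_in[OF A] by eventually_elim simp
    qed (intro scale_\<B> indicator_\<B> A' bounded_measurable_const)+
    finally show "k * L (indicator A) \<le> K + energy (\<lambda>_. 0)" .
  qed
qed (use A sets_lam in \<open>auto intro: L_indicator_nonneg\<close>)

definition rep :: "'z measure" where
  "rep = measure_of \<Omega> (sets (borel_on \<Omega>)) (\<lambda>A. ennreal (L (indicator A)))"

lemma sets_rep: "sets rep = sets (borel_on \<Omega>)"
  unfolding rep_def using sets.sigma_sets_eq[of "borel_on \<Omega>"] sets.space_closed[of "borel_on \<Omega>"]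
  by (simp add: space_borel_on_\<Omega>)

lemma space_rep: "space rep = \<Omega>"
  using sets_eq_imp_space_eq[OF sets_rep] by (simp add: space_borel_on_\<Omega>)

text \<open>The indicators of the finite unions converge boundedly to that of the whole union.\<close>

lemma L_indicator_sums:
  assumes A: "range A \<subseteq> sets (borel_on \<Omega>)" "disjoint_family A"
  shows "(\<lambda>i. L (indicator (A i))) sums L (indicator (\<Union>i. A i))"
proof -
  have A': "A i \<in> sets (borel_on \<Omega>)" for i using A by auto
  have part: "L (indicator (\<Union>i<n. A i)) = (\<Sum>i<n. L (indicator (A i)))" for n
  proof (induction n)
    case 0
    then show ?case by (simp add: L_zero)
  next
    case (Suc n)
    have "(\<Union>i<n. A i) \<inter> A n = {}"
      using A(2) by (auto simp: disjoint_family_on_def) (metis IntI empty_iff less_irrefl)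
    then have "indicator (\<Union>i<Suc n. A i) = (\<lambda>x. 1 * indicator (\<Union>i<n. A i) x + 1 * indicator (A n) x :: real)"
      by (auto simp: indicator_def fun_eq_iff lessThan_Suc)
    then have "L (indicator (\<Union>i<Suc n. A i)) = 1 * L (indicator (\<Union>i<n. A i)) + 1 * L (indicator (A n))"
      using A' by (simp only:) (intro linear indicator_\<B>, auto)
    then show ?case using Suc by simp
  qed
  have "(\<lambda>n. L (indicator (\<Union>i<n. A i))) \<longlonglongrightarrow> L (indicator (\<Union>i. A i))"
    by (rule L_bounded_convergence[where B=1])
      (use A' LIMSEQ_indicator_UN[of A] in \<open>auto intro!: indicator_\<B> simp: indicator_le_1\<close>)
  then show ?thesis unfolding part sums_def .
qed

lemma emeasure_rep:
  assumes "A \<in> sets (borel_on \<Omega>)" shows "emeasure rep A = ennreal (L (indicator A))"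
proof (rule emeasure_measure_of[OF rep_def])
  show "sets (borel_on \<Omega>) \<subseteq> Pow \<Omega>" using sets.space_closed[of "borel_on \<Omega>"] by (simp add: space_borel_on_\<Omega>)
  show "A \<in> sets rep" using assms by (simp add: sets_rep)
  show "positive (sets rep) (\<lambda>A. ennreal (L (indicator A)))"
  proof -
    have "indicator {} = (\<lambda>_ :: 'z. 0 :: real)" by auto
    then show ?thesis using L_zero by (simp add: positive_def)
  qed
  show "countably_additive (sets rep) (\<lambda>A. ennreal (L (indicator A)))"
    unfolding countably_additive_def sets_rep
  proof (intro allI impI)
    fix A :: "nat \<Rightarrow> 'z set" assume A: "range A \<subseteq> sets (borel_on \<Omega>)" "disjoint_family A"
    show "(\<Sum>i. ennreal (L (indicator (A i)))) = ennreal (L (indicator (\<Union>i. A i)))"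
      using L_indicator_sums[OF A] A(1) L_indicator_nonneg
      by (intro sums_unique[symmetric] sums_ennreal[THEN iffD2]) (auto intro: L_indicator_nonneg)
  qed
qed

lemma rep_finite_radon: "rep \<in> finite_radon \<Omega>"
proof -
  have "emeasure rep (space rep) \<noteq> \<infinity>"
    using emeasure_rep[OF sets.top] by (simp add: space_rep space_borel_on_\<Omega>)
  then show ?thesis by (auto simp: finite_radon_def sets_rep intro: finite_measureI)
qed

lemma absolutely_continuous_rep: "absolutely_continuous lam rep"
  unfolding absolutely_continuous_def
  using L_indicator_null by (auto simp: null_sets_def sets_lam sets_rep emeasure_rep)

text \<open>Both sides are linear, agree on indicators and are continuous under bounded pointwise convergence.\<close>

lemma L_eq_integral_rep: "f \<in> \<B> \<Longrightarrow> L f = (\<integral>z. f z \<partial>rep)"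
proof (induction rule: bounded_measurable_induct)
  case (indicator A)
  then show ?case
    using L_indicator_nonneg[of A] by (simp add: sets_rep measure_def emeasure_rep)
next
  case (lincomb f g a b)
  then have "integrable rep f" "integrable rep g"
    using finite_radon_integrable[OF rep_finite_radon] by auto
  then show ?case using lincomb by (simp add: linear)
next
  case (lim F f B)
  have bound: "\<And>n z. z \<in> \<Omega> \<Longrightarrow> \<bar>F n z\<bar> \<le> B" and conv: "\<And>z. z \<in> \<Omega> \<Longrightarrow> (\<lambda>n. F n z) \<longlonglongrightarrow> f z"
    using lim(2,3) by (auto simp: space_borel_on_\<Omega>)
  have "f \<in> \<B>"
    by (rule bounded_measurable_lim[of F _ B])
      (use lim(1) bound conv in \<open>auto simp: space_borel_on_\<Omega> dest: bounded_measurable_measurable\<close>)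
  with lim(1) bound conv have "(\<lambda>n. L (F n)) \<longlonglongrightarrow> L f"
    by (rule L_bounded_convergence)
  moreover have "(\<lambda>n. L (F n)) \<longlonglongrightarrow> (\<integral>z. f z \<partial>rep)"
    unfolding lim(4) using rep_finite_radon lim(1) bound conv by (rule finite_radon_bounded_convergence)
  ultimately show ?case by (rule LIMSEQ_unique)
qed

end

section \<open>The conjugate of the energy\<close>

context superlinear_quasi_young
begin

text \<open>The best slope for \<open>t\<close> among \<open>0\<close> and the first \<open>n\<close> rational numbers, where a slope \<open>q\<close> is rated by
\<open>q * t - \<psi> q\<close>. Recursion, rather than a maximum over a finite set, makes measurability in \<open>t\<close> immediate.
Starting with \<open>0\<close> bounds all ratings below by \<open>- \<psi> 0\<close>.\<close>

primrec greedy :: "nat \<Rightarrow> real \<Rightarrow> real" where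
  "greedy 0 t = 0"
| "greedy (Suc n) t = (let q = real_of_rat (from_nat n) in
     if greedy n t * t - \<psi> (greedy n t) < q * t - \<psi> q then q else greedy n t)"

lemma greedy_bounded: "\<exists>B. \<forall>t. \<bar>greedy n t\<bar> \<le> B"
proof (induction n)
  case (Suc n)
  then obtain B where "\<And>t. \<bar>greedy n t\<bar> \<le> B" by auto
  then have "\<bar>greedy (Suc n) t\<bar> \<le> max B \<bar>real_of_rat (from_nat n)\<bar>" for t
    by (auto simp: Let_def le_max_iff_disj)
  then show ?case by blast
qed auto

lemma measurable_greedy [measurable]: "greedy n \<in> borel_measurable borel"
proof (induction n)
  case (Suc n)
  note [measurable] = Suc
  show ?case unfolding greedy.simps Let_def by measurable
qed simp

definition greedy_value :: "nat \<Rightarrow> real \<Rightarrow> real" where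
  "greedy_value n t = greedy n t * t - \<psi> (greedy n t)"

lemma measurable_greedy_value [measurable]: "greedy_value n \<in> borel_measurable borel"
  unfolding greedy_value_def by measurable

lemma greedy_value_Suc:
  "greedy_value n t \<le> greedy_value (Suc n) t"
  "real_of_rat (from_nat n) * t - \<psi> (real_of_rat (from_nat n)) \<le> greedy_value (Suc n) t"
  by (auto simp: greedy_value_def Let_def)

lemma greedy_value_mono: "m \<le> n \<Longrightarrow> greedy_value m t \<le> greedy_value n t"
  by (rule lift_Suc_mono_le[of "\<lambda>n. greedy_value n t"]) (rule greedy_value_Suc)

text \<open>Every rational number is tried after finitely many steps.\<close>

lemma SUP_greedy_value:
  assumes t: "t \<ge> 0" shows "(SUP n. ereal (greedy_value n t)) = infty_ext \<Phi> t"
proof (rule antisym)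
  show "(SUP n. ereal (greedy_value n t)) \<le> infty_ext \<Phi> t"
    unfolding greedy_value_def by (intro SUP_least young_inequality)
  show "infty_ext \<Phi> t \<le> (SUP n. ereal (greedy_value n t))"
    unfolding biconjugate_rat[OF t]
  proof (rule SUP_least)
    fix q :: rat
    have "ereal (real_of_rat q * t - \<psi> (real_of_rat q)) \<le> ereal (greedy_value (Suc (to_nat q)) t)"
      using greedy_value_Suc(2)[of "to_nat q" t] by simp
    also have "\<dots> \<le> (SUP n. ereal (greedy_value n t))" by (rule SUP_upper) simp
    finally show "ereal (real_of_rat q * t - \<psi> (real_of_rat q)) \<le> (SUP n. ereal (greedy_value n t))" .
  qed
qed

end

context transport_energy
begin

text \<open>Two measures occur in order to cover signed measures; for a single measure, \<open>n\<close> is the null measure.\<close>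

lemma bound_extends_to_bounded_borel:
  assumes p: "p \<in> finite_radon \<Omega>" and n: "n \<in> finite_radon \<Omega>"
    and bound: "\<And>f. continuous_on \<Omega> f \<Longrightarrow> (\<integral>z. f z \<partial>p) - (\<integral>z. f z \<partial>n) \<le> K + energy f"
    and f: "f \<in> \<B>"
  shows "(\<integral>z. f z \<partial>p) - (\<integral>z. f z \<partial>n) \<le> K + energy f"
  using compact f
proof (induction rule: bounded_borel_induct)
  case (continuous f)
  then show ?case by (rule bound)
next
  case (lim F f B)
  have conv: "(\<lambda>k. \<integral>z. F k z \<partial>M) \<longlonglongrightarrow> (\<integral>z. f z \<partial>M)" if "M \<in> finite_radon \<Omega>" for M
    using that lim(1-3) by (rule finite_radon_bounded_convergence)
  have "(\<lambda>k. (\<integral>z. F k z \<partial>p) - (\<integral>z. F k z \<partial>n)) \<longlonglongrightarrow> (\<integral>z. f z \<partial>p) - (\<integral>z. f z \<partial>n)"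
    by (intro tendsto_diff conv p n)
  moreover have "(\<lambda>k. K + energy (F k)) \<longlonglongrightarrow> K + energy f"
    using lim by (intro tendsto_intros energy_bounded_convergence[where B=B]) auto
  ultimately show ?case
    by (rule LIMSEQ_le) (use lim in auto)
qed

text \<open>Substituting \<open>g = (f - c) / \<gamma>\<close> and passing to densities turns \<open>\<integral> f \<partial>\<pi> - energy f\<close> into the integral of
\<open>g * h - \<psi> (g)\<close>, to which the Young inequality applies pointwise.\<close>

lemma young_identity:
  assumes \<pi>: "\<pi> \<in> finite_radon \<Omega>" and ac: "absolutely_continuous lam \<pi>" and f: "f \<in> \<B>"
    and h: "h = (\<lambda>z. enn2real (RN_deriv lam \<pi> z))"
  shows "integrable lam (\<lambda>z. (f z - c z) / \<gamma> * h z - \<psi> ((f z - c z) / \<gamma>))" (is ?A)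
    and "(\<integral>z. f z \<partial>\<pi>) - energy f =
      (\<integral>z. c z \<partial>\<pi>) + \<gamma> * (\<integral>z. (f z - c z) / \<gamma> * h z - \<psi> ((f z - c z) / \<gamma>) \<partial>lam)" (is ?B)
proof -
  interpret \<pi>: finite_measure \<pi> using finite_radonD[OF \<pi>] by simp
  have sets: "sets \<pi> = sets lam" using finite_radonD[OF \<pi>] sets_lam by simp
  let ?g = "\<lambda>z. (f z - c z) / \<gamma>"
  have g: "?g \<in> \<B>" using f by (rule \<B>_arg)
  note RN = RN_deriv_integrable[OF \<pi>.sigma_finite_measure_axioms ac sets \<B>_measurable_lam[OF g]]
    RN_deriv_integral[OF \<pi>.sigma_finite_measure_axioms ac sets \<B>_measurable_lam[OF g]]
  have int: "integrable lam (\<lambda>z. ?g z * h z)" "(\<integral>z. ?g z \<partial>\<pi>) = (\<integral>z. ?g z * h z \<partial>lam)"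
    using RN finite_radon_integrable[OF \<pi> g] by (simp_all add: h mult.commute)
  show ?A using int(1) integrable_energy[OF f] by (rule Bochner_Integration.integrable_diff)
  have "(\<integral>z. ?g z * h z - \<psi> (?g z) \<partial>lam) = (\<integral>z. ?g z \<partial>\<pi>) - (\<integral>z. \<psi> (?g z) \<partial>lam)"
    unfolding int(2) using int(1) integrable_energy[OF f] by (rule Bochner_Integration.integral_diff)
  then have "\<gamma> * (\<integral>z. ?g z * h z - \<psi> (?g z) \<partial>lam) = \<gamma> * (\<integral>z. ?g z \<partial>\<pi>) - energy f"
    by (simp only: energy_def right_diff_distrib)
  moreover have "(\<integral>z. f z \<partial>\<pi>) = (\<integral>z. c z \<partial>\<pi>) + \<gamma> * (\<integral>z. ?g z \<partial>\<pi>)"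
    using finite_radon_integrable[OF \<pi> f] finite_radon_integrable[OF \<pi> c_\<B>] \<gamma> by simp
  ultimately show ?B by simp
qed

text \<open>The interchange of supremum and integral. For the harder inequality, a real upper bound \<open>K\<close> of the
conjugate bounds \<open>\<integral> g * h - \<psi> (g) \<partial>lam\<close> for all bounded Borel \<open>g\<close>, in particular for the greedy choices
\<open>greedy n (h z)\<close>, whose integrands increase to \<open>\<Phi>\<^sub>\<infinity> (h z)\<close>.\<close>

theorem conjugate_energy:
  assumes \<pi>: "\<pi> \<in> finite_radon \<Omega>" and ac: "absolutely_continuous lam \<pi>"
  shows "functional_conj (cont_funs \<Omega>) (Pstar_G c \<gamma> \<Phi> lam) (\<lambda>f. \<integral>z. f z \<partial>\<pi>) = P_obj c \<gamma> \<Phi> lam \<pi>"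
proof -
  define h where "h = (\<lambda>z. enn2real (RN_deriv lam \<pi> z))"
  have h0: "h z \<ge> 0" for z by (simp add: h_def)
  have h_meas [measurable]: "h \<in> borel_measurable lam" by (simp add: h_def)
  let ?v = "\<lambda>z. infty_ext \<Phi> (h z)"
  have P_obj: "P_obj c \<gamma> \<Phi> lam \<pi> = ereal (\<integral>z. c z \<partial>\<pi>) + ereal \<gamma> * ereal_integral lam ?v"
    by (simp add: P_obj_def h_def)
  have conj: "functional_conj (cont_funs \<Omega>) (Pstar_G c \<gamma> \<Phi> lam) (\<lambda>f. \<integral>z. f z \<partial>\<pi>) =
      (SUP f\<in>cont_funs \<Omega>. ereal ((\<integral>z. f z \<partial>\<pi>) - energy f))"
    unfolding functional_conj_def
    by (intro SUP_cong) (auto simp: cont_funs_def Pstar_G_eq_energy continuous_bounded_measurable[OF compact])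
  show ?thesis
  proof (rule antisym)
    show "functional_conj (cont_funs \<Omega>) (Pstar_G c \<gamma> \<Phi> lam) (\<lambda>f. \<integral>z. f z \<partial>\<pi>) \<le> P_obj c \<gamma> \<Phi> lam \<pi>"
      unfolding conj
    proof (rule SUP_least)
      fix f assume "f \<in> cont_funs \<Omega>"
      then have f: "f \<in> \<B>" by (auto simp: cont_funs_def intro: continuous_bounded_measurable[OF compact])
      note id = young_identity[OF \<pi> ac f h_def]
      have "ereal (\<integral>z. (f z - c z) / \<gamma> * h z - \<psi> ((f z - c z) / \<gamma>) \<partial>lam) \<le> ereal_integral lam ?v"
        by (rule ereal_integral_ge[OF id(1)]) (rule young_inequality)
      then have "ereal \<gamma> * ereal (\<integral>z. (f z - c z) / \<gamma> * h z - \<psi> ((f z - c z) / \<gamma>) \<partial>lam) \<le> ereal \<gamma> * ereal_integral lam ?v"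
        using \<gamma> by (intro ereal_mult_left_mono) auto
      then show "ereal ((\<integral>z. f z \<partial>\<pi>) - energy f) \<le> P_obj c \<gamma> \<Phi> lam \<pi>"
        unfolding P_obj id(2) by (simp add: add_left_mono flip: plus_ereal.simps(1))
    qed
    show "P_obj c \<gamma> \<Phi> lam \<pi> \<le> functional_conj (cont_funs \<Omega>) (Pstar_G c \<gamma> \<Phi> lam) (\<lambda>f. \<integral>z. f z \<partial>\<pi>)"
    proof (rule ereal_le_real)
      fix K assume K: "functional_conj (cont_funs \<Omega>) (Pstar_G c \<gamma> \<Phi> lam) (\<lambda>f. \<integral>z. f z \<partial>\<pi>) \<le> ereal K"
      have le_cont: "(\<integral>z. f z \<partial>\<pi>) \<le> K + energy f" if "continuous_on \<Omega> f" for f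
      proof -
        have "ereal ((\<integral>z. f z \<partial>\<pi>) - energy f) \<le> ereal K"
          using K that unfolding conj by (auto simp: SUP_le_iff cont_funs_def)
        then show ?thesis by simp
      qed
      have le: "(\<integral>z. f z \<partial>\<pi>) - energy f \<le> K" if "f \<in> \<B>" for f
        using bound_extends_to_bounded_borel[OF \<pi> null_measure_finite_radon _ that, of K] le_cont by simp
      \<comment> \<open>The bound \<open>K\<close> in terms of \<open>g\<close>, where \<open>f = c + \<gamma> * g\<close>.\<close>
      define K' where "K' = (K - (\<integral>z. c z \<partial>\<pi>)) / \<gamma>"
      have int_le: "integrable lam (\<lambda>z. g z * h z - \<psi> (g z)) \<and> (\<integral>z. g z * h z - \<psi> (g z) \<partial>lam) \<le> K'" if g: "g \<in> \<B>" for g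
      proof -
        have f: "(\<lambda>z. 1 * c z + \<gamma> * g z) \<in> \<B>" using c_\<B> g by (rule bounded_measurable_lincomb)
        have "integrable lam (\<lambda>z. g z * h z - \<psi> (g z))"
          "(\<integral>z. c z \<partial>\<pi>) + \<gamma> * (\<integral>z. g z * h z - \<psi> (g z) \<partial>lam) \<le> K"
          using young_identity[OF \<pi> ac f h_def] le[OF f] \<gamma> by auto
        then show ?thesis using \<gamma> by (simp add: K'_def field_simps)
      qed
      \<comment> \<open>Shifting all integrands by \<open>C\<close> makes them nonnegative.\<close>
      define C where "C = \<psi> 0"
      have C: "C \<ge> 0" by (simp add: C_def \<psi>_nonneg)
      let ?m = "measure lam (space lam)"
      have v_meas: "?v \<in> borel_measurable lam"
        unfolding SUP_greedy_value[OF h0, symmetric]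
        by (intro borel_measurable_SUP) (auto simp: greedy_value_def)
      have u_ge: "- C \<le> greedy_value n t" for n t
        using greedy_value_mono[of 0 n t] by (simp add: greedy_value_def C_def)
      have u_C: "0 \<le> greedy_value n t + C" for n t
        using u_ge[of n t] by linarith
      have greedy_int: "integrable lam (\<lambda>z. greedy_value n (h z))" "(\<integral>z. greedy_value n (h z) \<partial>lam) \<le> K'" for n
      proof -
        obtain B where "\<And>t. \<bar>greedy n t\<bar> \<le> B" using greedy_bounded by blast
        then have "(\<lambda>z. greedy n (h z)) \<in> \<B>" by (intro \<B>_I) auto
        from int_le[OF this] show "integrable lam (\<lambda>z. greedy_value n (h z))"
          "(\<integral>z. greedy_value n (h z) \<partial>lam) \<le> K'" by (auto simp: greedy_value_def)
      qed
      have part: "(\<integral>\<^sup>+z. ennreal (greedy_value n (h z) + C) \<partial>lam) \<le> ennreal (K' + C * ?m)" for n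
      proof -
        have "(\<integral>\<^sup>+z. ennreal (greedy_value n (h z) + C) \<partial>lam) = ennreal (\<integral>z. greedy_value n (h z) + C \<partial>lam)"
          using greedy_int(1)[of n] u_C by (intro nn_integral_eq_integral) auto
        also have "(\<integral>z. greedy_value n (h z) + C \<partial>lam) \<le> K' + C * ?m"
          using greedy_int[of n] by (simp add: mult.commute)
        finally show ?thesis by (simp add: ennreal_leI)
      qed
      have "e2ennreal (?v z + ereal C) = (SUP n. ennreal (greedy_value n (h z) + C))" for z
      proof -
        have lim: "(\<lambda>n. ereal (greedy_value n (h z))) \<longlonglongrightarrow> ?v z"
          unfolding SUP_greedy_value[OF h0, symmetric]
          by (intro LIMSEQ_SUP) (auto simp: incseq_def greedy_value_mono)
        have "(\<lambda>n. e2ennreal (ereal (greedy_value n (h z)) + ereal C)) \<longlonglongrightarrow> e2ennreal (?v z + ereal C)"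
          by (intro tendsto_e2ennrealI tendsto_add_ereal_general lim tendsto_const) auto
        moreover have "(\<lambda>n. ennreal (greedy_value n (h z) + C)) \<longlonglongrightarrow> (SUP n. ennreal (greedy_value n (h z) + C))"
          by (intro LIMSEQ_SUP) (auto simp: incseq_def greedy_value_mono intro: ennreal_leI)
        ultimately show ?thesis by (auto intro: LIMSEQ_unique)
      qed
      then have "(\<integral>\<^sup>+z. e2ennreal (?v z + ereal C) \<partial>lam) = (SUP n. \<integral>\<^sup>+z. ennreal (greedy_value n (h z) + C) \<partial>lam)"
        by (simp only:) (rule nn_integral_monotone_convergence_SUP,
          auto simp: incseq_def le_fun_def greedy_value_mono intro!: ennreal_leI)
      also have "\<dots> \<le> ennreal (K' + C * ?m)" by (intro SUP_least part)
      finally have J: "(\<integral>\<^sup>+z. e2ennreal (?v z + ereal C) \<partial>lam) \<le> ennreal (K' + C * ?m)" .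
      have "0 \<le> K' + C * ?m"
      proof -
        have "- C * ?m \<le> (\<integral>z. greedy_value 0 (h z) \<partial>lam)" by (simp add: greedy_value_def C_def)
        then show ?thesis using greedy_int(2)[of 0] by simp
      qed
      with J have J': "enn2ereal (\<integral>\<^sup>+z. e2ennreal (?v z + ereal C) \<partial>lam) \<le> ereal (K' + C * ?m)"
        by (simp add: less_eq_ennreal.rep_eq enn2ereal_ennreal)
      have "ereal (- C) \<le> ?v z" for z
        using young_inequality[of 0 "h z"] by (simp add: C_def)
      then have "ereal_integral lam ?v = enn2ereal (\<integral>\<^sup>+z. e2ennreal (?v z + ereal C) \<partial>lam) - ereal (C * ?m)"
        by (intro ereal_integral_bounded_below v_meas C)
      also have "\<dots> \<le> ereal (K' + C * ?m) - ereal (C * ?m)" using J' by (rule ereal_minus_mono) simp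
      finally have "ereal_integral lam ?v \<le> ereal K'" by simp
      then have "ereal \<gamma> * ereal_integral lam ?v \<le> ereal \<gamma> * ereal K'"
        using \<gamma> by (intro ereal_mult_left_mono) auto
      then have "P_obj c \<gamma> \<Phi> lam \<pi> \<le> ereal (\<integral>z. c z \<partial>\<pi>) + ereal \<gamma> * ereal K'"
        unfolding P_obj by (rule add_left_mono)
      then show "P_obj c \<gamma> \<Phi> lam \<pi> \<le> ereal K" using \<gamma> by (simp add: K'_def)
    qed
  qed
qed

end

section \<open>Signed measures and measures on products\<close>

text \<open>The identity, written with the projections, is measurable in both directions.\<close>

lemma sets_pair_borel_on:
  fixes S :: "'a::second_countable_topology set" and T :: "'b::second_countable_topology set"
  shows "sets (borel_on S \<Otimes>\<^sub>M borel_on T) = sets (borel_on (S \<times> T))" (is "sets ?P = sets ?R")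
proof -
  have sp: "space ?P = S \<times> T" "space ?R = S \<times> T"
    by (auto simp: space_pair_measure space_restrict_space)
  have "(\<lambda>z. (fst z, snd z)) \<in> ?R \<rightarrow>\<^sub>M ?P"
    unfolding borel_prod[symmetric]
    by (intro measurable_Pair measurable_restrict_space2 measurable_restrict_space1) (auto simp: space_restrict_space)
  moreover have "(\<lambda>z. (fst z, snd z)) \<in> ?P \<rightarrow>\<^sub>M ?R"
  proof (rule measurable_restrict_space2)
    have "fst \<in> ?P \<rightarrow>\<^sub>M borel" "snd \<in> ?P \<rightarrow>\<^sub>M borel"
      using measurable_compose[OF measurable_fst measurable_restrict_space1[OF measurable_ident]]
        measurable_compose[OF measurable_snd measurable_restrict_space1[OF measurable_ident]]
      by (simp_all add: o_def id_def)
    then show "(\<lambda>z. (fst z, snd z)) \<in> borel_measurable ?P" by (rule borel_measurable_Pair)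
  qed (auto simp: space_pair_measure space_restrict_space)
  ultimately have id: "(\<lambda>z. z) \<in> ?R \<rightarrow>\<^sub>M ?P" "(\<lambda>z. z) \<in> ?P \<rightarrow>\<^sub>M ?R" by simp_all
  have "A \<in> sets ?R" if "A \<in> sets ?P" for A
    using measurable_sets[OF id(1) that] sets.sets_into_space[OF that] unfolding sp
    by (simp add: vimage_def Int_absorb2)
  moreover have "A \<in> sets ?P" if "A \<in> sets ?R" for A
    using measurable_sets[OF id(2) that] sets.sets_into_space[OF that] unfolding sp
    by (simp add: vimage_def Int_absorb2)
  ultimately show ?thesis by blast
qed

text \<open>This makes the integral with respect to a signed measure well defined on bounded Borel functions. The
equation \<open>p + n' = p' + n\<close> of measures is tested on indicators first.\<close>

lemma decomposes_integral_eq: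
  assumes d: "decomposes S \<nu> p n" "decomposes S \<nu> p' n'" and f: "f \<in> bounded_measurable (borel_on S)"
  shows "(\<integral>x. f x \<partial>p) - (\<integral>x. f x \<partial>n) = (\<integral>x. f x \<partial>p') - (\<integral>x. f x \<partial>n')"
proof -
  have M: "p \<in> finite_radon S" "n \<in> finite_radon S" "p' \<in> finite_radon S" "n' \<in> finite_radon S"
    using d by (auto simp: decomposes_def)
  show ?thesis using f
  proof (induction rule: bounded_measurable_induct)
    case (indicator A)
    then have "\<nu> A = measure p A - measure n A" "\<nu> A = measure p' A - measure n' A"
      using d by (auto simp: decomposes_def)
    then show ?case
      using indicator M[THEN finite_radonD(2)] by simp
  next
    case (lincomb f g a b)
    have diff: "(\<integral>x. a * f x + b * g x \<partial>M) - (\<integral>x. a * f x + b * g x \<partial>N)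
        = a * ((\<integral>x. f x \<partial>M) - (\<integral>x. f x \<partial>N)) + b * ((\<integral>x. g x \<partial>M) - (\<integral>x. g x \<partial>N))"
      if "M \<in> finite_radon S" "N \<in> finite_radon S" for M N
      using lincomb(1,2) finite_radon_integrable[OF that(1)] finite_radon_integrable[OF that(2)]
      by (simp add: algebra_simps)
    show ?case unfolding diff[OF M(1,2)] diff[OF M(3,4)] lincomb(3,4) ..
  next
    case (lim F f B)
    have conv: "(\<lambda>k. (\<integral>x. F k x \<partial>M) - (\<integral>x. F k x \<partial>N)) \<longlonglongrightarrow> (\<integral>x. f x \<partial>M) - (\<integral>x. f x \<partial>N)"
      if "M \<in> finite_radon S" "N \<in> finite_radon S" for M N
      using lim that by (intro tendsto_diff finite_radon_bounded_convergence[of _ S F B])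
        (auto simp: space_restrict_space)
    show ?case
      using conv[OF M(1,2)] conv[OF M(3,4), folded lim(4)] by (rule LIMSEQ_unique)
  qed
qed

lemma signed_integral_eq:
  assumes "decomposes S \<nu> p n" "f \<in> bounded_measurable (borel_on S)"
  shows "signed_integral S \<nu> f = (\<integral>x. f x \<partial>p) - (\<integral>x. f x \<partial>n)"
  unfolding signed_integral_def
  using assms decomposes_integral_eq by (intro the_equality) blast+

lemma decomposes_measure:
  assumes "\<pi> \<in> finite_radon S" "\<forall>A\<in>sets (borel_on S). \<nu> A = measure \<pi> A"
  shows "decomposes S \<nu> \<pi> (null_measure (borel_on S))"
  using assms null_measure_finite_radon by (auto simp: decomposes_def measure_def)

lemma distr_finite_radon:
  assumes "finite_measure \<pi>" "g \<in> \<pi> \<rightarrow>\<^sub>M borel_on S"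
  shows "distr \<pi> (borel_on S) g \<in> finite_radon S"
  using finite_measure.finite_measure_distr[OF assms] by (simp add: finite_radon_def)

section \<open>Duality for regularized optimal transport\<close>

locale optimal_transport = superlinear_quasi_young \<Phi>
  for \<Phi> :: "real \<Rightarrow> ereal" +
  fixes \<Omega>1 :: "'a::{metric_space, second_countable_topology} set"
    and \<Omega>2 :: "'b::{metric_space, second_countable_topology} set"
    and lam1 \<mu>1 :: "'a measure" and lam2 \<mu>2 :: "'b measure"
    and c :: "'a \<times> 'b \<Rightarrow> real" and \<gamma> :: real
  assumes compact1: "compact \<Omega>1" and compact2: "compact \<Omega>2"
    and lam1: "lam1 \<in> finite_radon \<Omega>1" and lam2: "lam2 \<in> finite_radon \<Omega>2"
    and \<mu>1: "\<mu>1 \<in> prob_radon \<Omega>1" and \<mu>2: "\<mu>2 \<in> prob_radon \<Omega>2"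
    and cont_c: "continuous_on (\<Omega>1 \<times> \<Omega>2) c" and \<gamma>_pos: "\<gamma> > 0"
begin

lemma finite_radon_pair:
  assumes "M \<in> finite_radon \<Omega>1" "N \<in> finite_radon \<Omega>2"
  shows "M \<Otimes>\<^sub>M N \<in> finite_radon (\<Omega>1 \<times> \<Omega>2)"
proof -
  have "sets (M \<Otimes>\<^sub>M N) = sets (borel_on (\<Omega>1 \<times> \<Omega>2))"
    using assms sets_pair_measure_cong[of M "borel_on \<Omega>1" N "borel_on \<Omega>2"]
    by (simp add: finite_radon_def sets_pair_borel_on)
  then show ?thesis using assms finite_measure_pair_measure by (auto simp: finite_radon_def)
qed

sublocale transport_energy \<Phi> "\<Omega>1 \<times> \<Omega>2" "lam1 \<Otimes>\<^sub>M lam2" c \<gamma>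
  by unfold_locales
    (auto intro: compact_Times compact1 compact2 finite_radon_pair lam1 lam2 cont_c \<gamma>_pos)

abbreviation (input) "\<Omega> \<equiv> \<Omega>1 \<times> \<Omega>2"
abbreviation (input) "lam \<equiv> lam1 \<Otimes>\<^sub>M lam2"
abbreviation (input) "C12 \<equiv> cont_funs \<Omega>1 \<times> cont_funs \<Omega>2"

lemma measurable_projections:
  assumes "\<pi> \<in> finite_radon \<Omega>"
  shows "fst \<in> \<pi> \<rightarrow>\<^sub>M borel_on \<Omega>1" "snd \<in> \<pi> \<rightarrow>\<^sub>M borel_on \<Omega>2"
proof -
  have "sets \<pi> = sets (borel_on \<Omega>1 \<Otimes>\<^sub>M borel_on \<Omega>2)"
    using assms by (simp add: finite_radon_def sets_pair_borel_on)
  then show "fst \<in> \<pi> \<rightarrow>\<^sub>M borel_on \<Omega>1" "snd \<in> \<pi> \<rightarrow>\<^sub>M borel_on \<Omega>2"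
    by (simp_all cong: measurable_cong_sets)
qed

lemma continuous_on_summands:
  assumes "\<alpha> \<in> C12"
  shows "continuous_on \<Omega> (\<lambda>z. fst \<alpha> (fst z))" "continuous_on \<Omega> (\<lambda>z. snd \<alpha> (snd z))"
proof -
  have "continuous_on \<Omega>1 (fst \<alpha>)" "continuous_on \<Omega>2 (snd \<alpha>)"
    using assms by (auto simp: cont_funs_def)
  then show "continuous_on \<Omega> (\<lambda>z. fst \<alpha> (fst z))" "continuous_on \<Omega> (\<lambda>z. snd \<alpha> (snd z))"
    by (auto elim!: continuous_on_compose2 intro: continuous_intros)
qed

lemma continuous_on_oplus: "\<alpha> \<in> C12 \<Longrightarrow> continuous_on \<Omega> (oplus \<alpha>)"
  unfolding oplus_def[abs_def] by (intro continuous_on_add continuous_on_summands)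

lemma oplus_\<B>: "\<alpha> \<in> C12 \<Longrightarrow> oplus \<alpha> \<in> \<B>"
  by (rule continuous_bounded_measurable[OF compact continuous_on_oplus])

lemma C12_bounded:
  assumes "\<alpha> \<in> C12"
  shows "fst \<alpha> \<in> bounded_measurable (borel_on \<Omega>1)" "snd \<alpha> \<in> bounded_measurable (borel_on \<Omega>2)"
  using assms by (auto simp: cont_funs_def intro!: continuous_bounded_measurable compact1 compact2)

lemma integral_oplus:
  assumes \<pi>: "\<pi> \<in> finite_radon \<Omega>" and \<alpha>: "\<alpha> \<in> C12"
  shows "(\<integral>z. oplus \<alpha> z \<partial>\<pi>) = (\<integral>x. fst \<alpha> x \<partial>distr \<pi> (borel_on \<Omega>1) fst) + (\<integral>y. snd \<alpha> y \<partial>distr \<pi> (borel_on \<Omega>2) snd)"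
proof -
  note [measurable] = measurable_projections[OF \<pi>]
  have "integrable \<pi> (\<lambda>z. fst \<alpha> (fst z))" "integrable \<pi> (\<lambda>z. snd \<alpha> (snd z))"
    using finite_radon_integrable[OF \<pi> continuous_bounded_measurable[OF compact]] continuous_on_summands[OF \<alpha>] by auto
  moreover note C12_bounded[OF \<alpha>, THEN bounded_measurable_measurable]
  ultimately show ?thesis by (simp add: oplus_def integral_distr)
qed

definition marginal_integral :: "('a \<Rightarrow> real) \<times> ('b \<Rightarrow> real) \<Rightarrow> real" where
  "marginal_integral \<alpha> = (\<integral>x. fst \<alpha> x \<partial>\<mu>1) + (\<integral>y. snd \<alpha> y \<partial>\<mu>2)"

lemma product_finite_radon: "\<mu>1 \<Otimes>\<^sub>M \<mu>2 \<in> finite_radon \<Omega>"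
  by (intro finite_radon_pair prob_radon_imp_finite_radon \<mu>1 \<mu>2)

text \<open>The product measure has the prescribed marginals. Integration with respect to it
expresses the linear part of the predual objective through \<open>oplus \<alpha>\<close>, although \<open>\<alpha>\<close> is determined by
\<open>oplus \<alpha>\<close> only up to constants.\<close>

lemma integral_oplus_product:
  assumes \<alpha>: "\<alpha> \<in> C12"
  shows "(\<integral>z. oplus \<alpha> z \<partial>(\<mu>1 \<Otimes>\<^sub>M \<mu>2)) = marginal_integral \<alpha>"
proof -
  interpret \<mu>1: prob_space \<mu>1 using \<mu>1 by (simp add: prob_radon_def)
  interpret \<mu>2: prob_space \<mu>2 using \<mu>2 by (simp add: prob_radon_def)
  have "distr (\<mu>1 \<Otimes>\<^sub>M \<mu>2) (borel_on \<Omega>1) fst = distr (\<mu>1 \<Otimes>\<^sub>M \<mu>2) \<mu>1 fst"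
    using \<mu>1 by (intro distr_cong) (auto simp: prob_radon_def)
  then have 1: "distr (\<mu>1 \<Otimes>\<^sub>M \<mu>2) (borel_on \<Omega>1) fst = \<mu>1" by (simp add: \<mu>2.distr_pair_fst)
  have 2: "distr (\<mu>1 \<Otimes>\<^sub>M \<mu>2) (borel_on \<Omega>2) snd = \<mu>2"
  proof (rule measure_eqI)
    show "sets (distr (\<mu>1 \<Otimes>\<^sub>M \<mu>2) (borel_on \<Omega>2) snd) = sets \<mu>2"
      using \<mu>2 by (simp add: prob_radon_def)
    fix A assume "A \<in> sets (distr (\<mu>1 \<Otimes>\<^sub>M \<mu>2) (borel_on \<Omega>2) snd)"
    then have A: "A \<in> sets (borel_on \<Omega>2)" "A \<in> sets \<mu>2" using \<mu>2 by (auto simp: prob_radon_def)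
    have "snd -` A \<inter> space (\<mu>1 \<Otimes>\<^sub>M \<mu>2) = space \<mu>1 \<times> A"
      using sets.sets_into_space[OF A(2)] by (auto simp: space_pair_measure)
    then have "emeasure (distr (\<mu>1 \<Otimes>\<^sub>M \<mu>2) (borel_on \<Omega>2) snd) A = emeasure (\<mu>1 \<Otimes>\<^sub>M \<mu>2) (space \<mu>1 \<times> A)"
      using measurable_projections(2)[OF product_finite_radon] A(1) by (simp add: emeasure_distr)
    also have "\<dots> = emeasure \<mu>2 A"
      using A(2) by (simp add: \<mu>2.emeasure_pair_measure_Times \<mu>1.emeasure_space_1)
    finally show "emeasure (distr (\<mu>1 \<Otimes>\<^sub>M \<mu>2) (borel_on \<Omega>2) snd) A = emeasure \<mu>2 A" .
  qed
  show ?thesis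
    unfolding integral_oplus[OF product_finite_radon \<alpha>] 1 2 marginal_integral_def ..
qed

text \<open>The marginal constraints become linear equations in the form in which the duality argument tests them.
From right to left, one of the two functions is set to \<open>0\<close>, and a marginal is determined by its
integrals of continuous functions; the total mass is \<open>1\<close> because that of the marginals is.\<close>

lemma feasible_iff:
  "\<pi> \<in> P_feasible \<Omega>1 \<Omega>2 lam \<mu>1 \<mu>2 \<longleftrightarrow> \<pi> \<in> finite_radon \<Omega> \<and> absolutely_continuous lam \<pi> \<and>
     (\<forall>\<alpha>\<in>C12. (\<integral>z. oplus \<alpha> z \<partial>\<pi>) = marginal_integral \<alpha>)" (is "?L \<longleftrightarrow> ?R")
proof
  assume ?L
  then have "\<pi> \<in> finite_radon \<Omega>" "absolutely_continuous lam \<pi>" and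
    marg: "distr \<pi> (borel_on \<Omega>1) fst = \<mu>1" "distr \<pi> (borel_on \<Omega>2) snd = \<mu>2"
    by (auto simp: P_feasible_def prob_radon_imp_finite_radon)
  then show ?R using integral_oplus by (simp add: marg marginal_integral_def)
next
  assume R: ?R
  then have \<pi>: "\<pi> \<in> finite_radon \<Omega>" by simp
  interpret \<pi>: finite_measure \<pi> using \<pi> by (simp add: finite_radon_def)
  note proj = measurable_projections[OF \<pi>]
  have int: "(\<integral>x. fst \<alpha> x \<partial>distr \<pi> (borel_on \<Omega>1) fst) + (\<integral>y. snd \<alpha> y \<partial>distr \<pi> (borel_on \<Omega>2) snd)
      = (\<integral>x. fst \<alpha> x \<partial>\<mu>1) + (\<integral>y. snd \<alpha> y \<partial>\<mu>2)" if "\<alpha> \<in> C12" for \<alpha>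
  proof -
    have "(\<integral>z. oplus \<alpha> z \<partial>\<pi>) = marginal_integral \<alpha>" using R that by blast
    then show ?thesis unfolding integral_oplus[OF \<pi> that] marginal_integral_def .
  qed
  have 1: "distr \<pi> (borel_on \<Omega>1) fst = \<mu>1"
  proof (rule measure_eq_if_continuous_integrals_eq[OF compact1 distr_finite_radon[OF _ proj(1)] prob_radon_imp_finite_radon[OF \<mu>1]])
    show "(\<integral>x. f x \<partial>distr \<pi> (borel_on \<Omega>1) fst) = (\<integral>x. f x \<partial>\<mu>1)" if "continuous_on \<Omega>1 f" for f :: "'a \<Rightarrow> real"
      using int[of "(f, \<lambda>_. 0)"] that by (simp add: cont_funs_def)
  qed unfold_locales
  have 2: "distr \<pi> (borel_on \<Omega>2) snd = \<mu>2"
  proof (rule measure_eq_if_continuous_integrals_eq[OF compact2 distr_finite_radon[OF _ proj(2)] prob_radon_imp_finite_radon[OF \<mu>2]])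
    show "(\<integral>x. f x \<partial>distr \<pi> (borel_on \<Omega>2) snd) = (\<integral>x. f x \<partial>\<mu>2)" if "continuous_on \<Omega>2 f" for f :: "'b \<Rightarrow> real"
      using int[of "(\<lambda>_. 0, f)"] that by (simp add: cont_funs_def)
  qed unfold_locales
  have "prob_space (distr \<pi> (borel_on \<Omega>1) fst)" unfolding 1 using \<mu>1 by (simp add: prob_radon_def)
  then have "prob_space \<pi>" using proj(1) by (rule prob_space_distrD[rotated])
  then show ?L using R 1 2 by (auto simp: P_feasible_def prob_radon_def finite_radon_def)
qed

lemma zero_C12: "(\<lambda>_. 0, \<lambda>_. 0) \<in> C12" by (simp add: cont_funs_def)

lemma oplus_lincomb:
  assumes "\<alpha> \<in> C12" "\<beta> \<in> C12"
  obtains \<delta> where "\<delta> \<in> C12" "oplus \<delta> = (\<lambda>z. a * oplus \<alpha> z + b * oplus \<beta> z)"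
proof
  show "(\<lambda>x. a * fst \<alpha> x + b * fst \<beta> x, \<lambda>y. a * snd \<alpha> y + b * snd \<beta> y) \<in> C12"
    using assms by (auto simp: cont_funs_def intro!: continuous_intros)
qed (auto simp: oplus_def algebra_simps)

lemma Pstar_F_eq: "Pstar_F \<mu>1 \<mu>2 \<alpha> = ereal (- marginal_integral \<alpha>)"
  by (simp add: Pstar_F_def marginal_integral_def)

lemma Pstar_obj_eq_energy:
  assumes "\<alpha> \<in> C12"
  shows "Pstar_obj c \<gamma> \<Phi> lam \<mu>1 \<mu>2 \<alpha> = ereal (marginal_integral \<alpha> - energy (oplus \<alpha>))"
  using Pstar_G_eq_energy[OF oplus_\<B>[OF assms]]
  unfolding Pstar_obj_def Pstar_G_def[symmetric] marginal_integral_def by simp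

lemma conj_F_eq_0:
  assumes "\<And>\<alpha>. \<alpha> \<in> C12 \<Longrightarrow> l (oplus \<alpha>) = marginal_integral \<alpha>"
  shows "functional_conj C12 (Pstar_F \<mu>1 \<mu>2) (\<lambda>\<alpha>. - l (oplus \<alpha>)) = 0"
proof -
  have "functional_conj C12 (Pstar_F \<mu>1 \<mu>2) (\<lambda>\<alpha>. - l (oplus \<alpha>)) = (SUP \<alpha>\<in>C12. 0)"
    unfolding functional_conj_def using assms by (intro SUP_cong) (auto simp: Pstar_F_eq zero_ereal_def)
  also have "\<dots> = 0" using zero_C12 by (intro SUP_const) auto
  finally show ?thesis .
qed

text \<open>A violated constraint is amplified by scaling \<open>\<alpha>\<close>.\<close>

lemma conj_F_eq_PInfty:
  assumes lin: "\<And>f a. f \<in> \<B> \<Longrightarrow> l (\<lambda>z. a * f z) = a * l f"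
    and \<alpha>: "\<alpha> \<in> C12" "l (oplus \<alpha>) \<noteq> marginal_integral \<alpha>"
  shows "functional_conj C12 (Pstar_F \<mu>1 \<mu>2) (\<lambda>\<alpha>. - l (oplus \<alpha>)) = \<infinity>"
  unfolding functional_conj_def
proof (rule SUP_PInfty)
  fix n :: nat
  define D where "D = marginal_integral \<alpha> - l (oplus \<alpha>)"
  \<comment> \<open>The factor for which the value becomes exactly \<open>n\<close>.\<close>
  define k where "k = real n / D"
  define \<beta> where "\<beta> = (\<lambda>x. k * fst \<alpha> x, \<lambda>y. k * snd \<alpha> y)"
  have \<beta>: "\<beta> \<in> C12" using \<alpha> by (auto simp: \<beta>_def cont_funs_def intro!: continuous_intros)
  have "oplus \<beta> = (\<lambda>z. k * oplus \<alpha> z)" by (auto simp: \<beta>_def oplus_def algebra_simps)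
  then have "l (oplus \<beta>) = k * l (oplus \<alpha>)" using lin oplus_\<B>[OF \<alpha>(1)] by simp
  moreover have "marginal_integral \<beta> = k * marginal_integral \<alpha>"
    by (simp add: \<beta>_def marginal_integral_def algebra_simps)
  ultimately have "- l (oplus \<beta>) + marginal_integral \<beta> = k * D" by (simp add: D_def algebra_simps)
  also have "\<dots> = real n" using \<alpha>(2) by (simp add: k_def D_def)
  finally show "\<exists>\<alpha>\<in>C12. ereal (real n) \<le> ereal (- l (oplus \<alpha>)) - Pstar_F \<mu>1 \<mu>2 \<alpha>"
    using \<beta> by (intro bexI[of _ \<beta>]) (auto simp: Pstar_F_eq)
qed

lemma fenchel_dual_obj_signed:
  assumes "decomposes \<Omega> \<nu> p n"
  defines "l \<equiv> \<lambda>f :: 'a \<times> 'b \<Rightarrow> real. (\<integral>z. f z \<partial>p) - (\<integral>z. f z \<partial>n)"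
  shows "fenchel_dual_obj C12 (Pstar_F \<mu>1 \<mu>2) (cont_funs \<Omega>) (Pstar_G c \<gamma> \<Phi> lam) oplus (signed_integral \<Omega> \<nu>)
    = functional_conj C12 (Pstar_F \<mu>1 \<mu>2) (\<lambda>\<alpha>. - l (oplus \<alpha>)) + functional_conj (cont_funs \<Omega>) (Pstar_G c \<gamma> \<Phi> lam) l"
proof -
  have "functional_conj C12 (Pstar_F \<mu>1 \<mu>2) (\<lambda>\<alpha>. - signed_integral \<Omega> \<nu> (oplus \<alpha>))
      = functional_conj C12 (Pstar_F \<mu>1 \<mu>2) (\<lambda>\<alpha>. - l (oplus \<alpha>))"
    unfolding functional_conj_def
    by (intro SUP_cong) (auto simp: l_def signed_integral_eq[OF assms(1)] oplus_\<B>)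
  moreover have "functional_conj (cont_funs \<Omega>) (Pstar_G c \<gamma> \<Phi> lam) (signed_integral \<Omega> \<nu>)
      = functional_conj (cont_funs \<Omega>) (Pstar_G c \<gamma> \<Phi> lam) l"
    unfolding functional_conj_def
    by (intro SUP_cong) (auto simp: l_def cont_funs_def signed_integral_eq[OF assms(1)] continuous_bounded_measurable[OF compact])
  ultimately show ?thesis by (simp add: fenchel_dual_obj_def)
qed

text \<open>The null measure serves as the negative part of \<open>\<nu>\<close>. The marginal constraints make the conjugate of the
linear part vanish, so only the conjugate of the energy is left.\<close>

theorem fenchel_dual_obj_feasible:
  assumes \<pi>: "\<pi> \<in> P_feasible \<Omega>1 \<Omega>2 lam \<mu>1 \<mu>2" and \<nu>: "\<forall>A\<in>sets (borel_on \<Omega>). \<nu> A = measure \<pi> A"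
  shows "fenchel_dual_obj C12 (Pstar_F \<mu>1 \<mu>2) (cont_funs \<Omega>) (Pstar_G c \<gamma> \<Phi> lam) oplus (signed_integral \<Omega> \<nu>)
    = P_obj c \<gamma> \<Phi> lam \<pi>"
proof -
  have \<pi>': "\<pi> \<in> finite_radon \<Omega>" "absolutely_continuous lam \<pi>"
    "\<And>\<alpha>. \<alpha> \<in> C12 \<Longrightarrow> (\<integral>z. oplus \<alpha> z \<partial>\<pi>) = marginal_integral \<alpha>"
    using \<pi> unfolding feasible_iff by auto
  show ?thesis
    using fenchel_dual_obj_signed[OF decomposes_measure[OF \<pi>'(1) \<nu>]] conj_F_eq_0[of "\<lambda>f. \<integral>z. f z \<partial>\<pi>"] \<pi>'(3)
      conjugate_energy[OF \<pi>'(1,2)]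
    by simp
qed

lemma functional_conj_energy_le_iff:
  "functional_conj (cont_funs \<Omega>) (Pstar_G c \<gamma> \<Phi> lam) l \<le> ereal K \<longleftrightarrow>
    (\<forall>f. continuous_on \<Omega> f \<longrightarrow> l f \<le> K + energy f)"
proof -
  have "ereal (l f) - Pstar_G c \<gamma> \<Phi> lam f \<le> ereal K \<longleftrightarrow> l f \<le> K + energy f" if "continuous_on \<Omega> f" for f
    using Pstar_G_eq_energy[OF continuous_bounded_measurable[OF compact that]] by (auto simp: algebra_simps)
  then show ?thesis by (simp add: functional_conj_def SUP_le_iff cont_funs_def)
qed

text \<open>In extended arithmetic a sum is \<open>\<infinity>\<close> as soon as one summand is, so both conjugates are below \<open>\<infinity>\<close>
here. That of the energy makes \<open>\<nu>\<close> an absolutely continuous nonnegative measure, that of the linear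
part gives it the right marginals.\<close>

theorem fenchel_dual_obj_infeasible:
  assumes \<nu>: "\<nu> \<in> signed_radon \<Omega>"
    and fin: "fenchel_dual_obj C12 (Pstar_F \<mu>1 \<mu>2) (cont_funs \<Omega>) (Pstar_G c \<gamma> \<Phi> lam) oplus (signed_integral \<Omega> \<nu>) \<noteq> \<infinity>"
  shows "\<exists>\<pi>\<in>P_feasible \<Omega>1 \<Omega>2 lam \<mu>1 \<mu>2. \<forall>A\<in>sets (borel_on \<Omega>). \<nu> A = measure \<pi> A"
proof -
  obtain p n where d: "decomposes \<Omega> \<nu> p n" using \<nu> by (auto simp: signed_radon_def)
  then have p: "p \<in> finite_radon \<Omega>" and n: "n \<in> finite_radon \<Omega>" by (auto simp: decomposes_def)
  define l where "l = (\<lambda>f :: 'a \<times> 'b \<Rightarrow> real. (\<integral>z. f z \<partial>p) - (\<integral>z. f z \<partial>n))"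
  have finF: "functional_conj C12 (Pstar_F \<mu>1 \<mu>2) (\<lambda>\<alpha>. - l (oplus \<alpha>)) \<noteq> \<infinity>"
    and finG: "functional_conj (cont_funs \<Omega>) (Pstar_G c \<gamma> \<Phi> lam) l \<noteq> \<infinity>"
    using fin unfolding fenchel_dual_obj_signed[OF d] l_def by auto
  have lin: "l (\<lambda>z. a * f z + b * g z) = a * l f + b * l g" if "f \<in> \<B>" "g \<in> \<B>" for f g a b
    using finite_radon_integrable[OF p] finite_radon_integrable[OF n] that by (simp add: l_def algebra_simps)
  obtain K where K: "functional_conj (cont_funs \<Omega>) (Pstar_G c \<gamma> \<Phi> lam) l \<le> ereal K"
    using finG by (cases "functional_conj (cont_funs \<Omega>) (Pstar_G c \<gamma> \<Phi> lam) l") auto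
  have dom: "l f \<le> K + energy f" if "f \<in> \<B>" for f
    unfolding l_def
    by (rule bound_extends_to_bounded_borel[OF p n _ that])
      (use K in \<open>auto simp: functional_conj_energy_le_iff l_def\<close>)
  interpret energy_dominated_functional \<Phi> \<Omega> lam c \<gamma> l K
    by unfold_locales (fact lin dom)+
  have "\<nu> A = measure rep A" if "A \<in> sets (borel_on \<Omega>)" for A
  proof -
    have "\<nu> A = l (indicator A)"
      using d that finite_radonD(2)[OF p] finite_radonD(2)[OF n] by (auto simp: decomposes_def l_def)
    then show ?thesis using that L_eq_integral_rep[OF indicator_\<B>[OF that]] by (simp add: sets_rep)
  qed
  moreover have "rep \<in> P_feasible \<Omega>1 \<Omega>2 lam \<mu>1 \<mu>2"
    unfolding feasible_iff
  proof (intro conjI ballI rep_finite_radon absolutely_continuous_rep)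
    fix \<alpha> assume \<alpha>: "\<alpha> \<in> C12"
    have "l (oplus \<alpha>) = marginal_integral \<alpha>"
      using conj_F_eq_PInfty[of l, OF L_scale \<alpha>] finF by blast
    then show "(\<integral>z. oplus \<alpha> z \<partial>rep) = marginal_integral \<alpha>"
      using L_eq_integral_rep[OF oplus_\<B>[OF \<alpha>]] by simp
  qed
  ultimately show ?thesis by blast
qed

text \<open>The energy part of the dual objective is a supremum over all continuous functions, of which
\<open>oplus \<alpha>\<close> is one.\<close>

lemma weak_duality:
  assumes \<alpha>: "\<alpha> \<in> C12" and \<pi>: "\<pi> \<in> P_feasible \<Omega>1 \<Omega>2 lam \<mu>1 \<mu>2"
  shows "Pstar_obj c \<gamma> \<Phi> lam \<mu>1 \<mu>2 \<alpha> \<le> P_obj c \<gamma> \<Phi> lam \<pi>"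
proof -
  have \<pi>': "\<pi> \<in> finite_radon \<Omega>" "absolutely_continuous lam \<pi>" "(\<integral>z. oplus \<alpha> z \<partial>\<pi>) = marginal_integral \<alpha>"
    using \<pi> \<alpha> unfolding feasible_iff by auto
  have "Pstar_obj c \<gamma> \<Phi> lam \<mu>1 \<mu>2 \<alpha> = ereal (\<integral>z. oplus \<alpha> z \<partial>\<pi>) - Pstar_G c \<gamma> \<Phi> lam (oplus \<alpha>)"
    unfolding Pstar_obj_eq_energy[OF \<alpha>] Pstar_G_eq_energy[OF oplus_\<B>[OF \<alpha>]] \<pi>'(3) by simp
  also have "\<dots> \<le> functional_conj (cont_funs \<Omega>) (Pstar_G c \<gamma> \<Phi> lam) (\<lambda>f. \<integral>z. f z \<partial>\<pi>)"
    unfolding functional_conj_def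
    by (rule SUP_upper) (use continuous_on_oplus[OF \<alpha>] in \<open>simp add: cont_funs_def\<close>)
  also have "\<dots> = P_obj c \<gamma> \<Phi> lam \<pi>" by (rule conjugate_energy[OF \<pi>'(1,2)])
  finally show ?thesis .
qed

text \<open>Existence of a minimizer and absence of a duality gap come from the same step: the linear functional
\<open>oplus \<alpha> \<mapsto> \<integral> \<alpha>\<^sub>1 \<partial>\<mu>1 + \<integral> \<alpha>\<^sub>2 \<partial>\<mu>2\<close> is extended to all bounded Borel functions under the majorant
\<open>s + energy\<close>, and the measure that represents the extension is a coupling with cost at most \<open>s\<close>.\<close>

theorem dual_bound_attained:
  assumes s: "\<And>\<alpha>. \<alpha> \<in> C12 \<Longrightarrow> Pstar_obj c \<gamma> \<Phi> lam \<mu>1 \<mu>2 \<alpha> \<le> ereal s"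
  shows "\<exists>\<pi>\<in>P_feasible \<Omega>1 \<Omega>2 lam \<mu>1 \<mu>2. P_obj c \<gamma> \<Phi> lam \<pi> \<le> ereal s"
proof -
  define l where "l = (\<lambda>f :: 'a \<times> 'b \<Rightarrow> real. \<integral>z. f z \<partial>(\<mu>1 \<Otimes>\<^sub>M \<mu>2))"
  have sub: "oplus ` C12 \<subseteq> \<B>" using oplus_\<B> by blast
  have lin: "l (\<lambda>z. a * f z + b * g z) = a * l f + b * l g" if "f \<in> \<B>" "g \<in> \<B>" for f g a b
    using finite_radon_integrable[OF product_finite_radon] that by (simp add: l_def)
  obtain L where lin_L: "\<And>f g a b. f \<in> \<B> \<Longrightarrow> g \<in> \<B> \<Longrightarrow> L (\<lambda>z. a * f z + b * g z) = a * L f + b * L g"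
    and dom: "\<And>f. f \<in> \<B> \<Longrightarrow> L f \<le> s + energy f" and L_ext: "\<And>f. f \<in> oplus ` C12 \<Longrightarrow> L f = l f"
  proof (rule hahn_banach_convex[of \<B> "\<lambda>f. s + energy f" "oplus ` C12" l])
    show "(\<lambda>_. 0) \<in> \<B>" by (rule bounded_measurable_const)
    show "(\<lambda>z. a * f z + b * g z) \<in> \<B>" if "f \<in> \<B>" "g \<in> \<B>" for f g a b
      using that by (rule bounded_measurable_lincomb)
    show "s + energy (\<lambda>z. (1 - u) * f z + u * g z) \<le> (1 - u) * (s + energy f) + u * (s + energy g)"
      if "f \<in> \<B>" "g \<in> \<B>" "0 \<le> u" "u \<le> 1" for f g u
      using energy_convex[OF that] by (simp add: algebra_simps)
    show "(\<lambda>_. 0) \<in> oplus ` C12"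
      using zero_C12 by (intro image_eqI[of _ _ "(\<lambda>_. 0, \<lambda>_. 0)"]) (auto simp: oplus_def)
    show "(\<lambda>z. a * f z + b * g z) \<in> oplus ` C12" if fg: "f \<in> oplus ` C12" "g \<in> oplus ` C12" for f g a b
    proof -
      obtain \<alpha> \<beta> where "\<alpha> \<in> C12" "\<beta> \<in> C12" "f = oplus \<alpha>" "g = oplus \<beta>" using fg by blast
      moreover then obtain \<delta> where "\<delta> \<in> C12" "oplus \<delta> = (\<lambda>z. a * oplus \<alpha> z + b * oplus \<beta> z)"
        using oplus_lincomb by blast
      ultimately show ?thesis by (intro image_eqI[of _ _ \<delta>]) auto
    qed
    show "l f \<le> s + energy f" if f: "f \<in> oplus ` C12" for f
    proof -
      obtain \<alpha> where \<alpha>: "\<alpha> \<in> C12" "f = oplus \<alpha>" using f by blast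
      then show ?thesis using s[OF \<alpha>(1)] integral_oplus_product[OF \<alpha>(1)]
        by (simp add: Pstar_obj_eq_energy[OF \<alpha>(1)] l_def)
    qed
    show "l (\<lambda>z. a * f z + b * g z) = a * l f + b * l g" if "f \<in> oplus ` C12" "g \<in> oplus ` C12" for f g a b
      using that sub by (intro lin) auto
  qed (rule sub, rule that)
  interpret energy_dominated_functional \<Phi> \<Omega> lam c \<gamma> L s
    by unfold_locales (fact lin_L dom)+
  have "rep \<in> P_feasible \<Omega>1 \<Omega>2 lam \<mu>1 \<mu>2"
    unfolding feasible_iff
  proof (intro conjI ballI rep_finite_radon absolutely_continuous_rep)
    fix \<alpha> assume \<alpha>: "\<alpha> \<in> C12"
    have "(\<integral>z. oplus \<alpha> z \<partial>rep) = L (oplus \<alpha>)" using L_eq_integral_rep[OF oplus_\<B>[OF \<alpha>]] by simp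
    also have "\<dots> = marginal_integral \<alpha>" using L_ext \<alpha> integral_oplus_product[OF \<alpha>] by (simp add: l_def)
    finally show "(\<integral>z. oplus \<alpha> z \<partial>rep) = marginal_integral \<alpha>" .
  qed
  moreover have "P_obj c \<gamma> \<Phi> lam rep \<le> ereal s"
    unfolding conjugate_energy[OF rep_finite_radon absolutely_continuous_rep, symmetric] functional_conj_energy_le_iff
    using dom L_eq_integral_rep continuous_bounded_measurable[OF compact] by auto
  ultimately show ?thesis by blast
qed

theorem strong_duality:
  shows "(INF \<pi>\<in>P_feasible \<Omega>1 \<Omega>2 lam \<mu>1 \<mu>2. P_obj c \<gamma> \<Phi> lam \<pi>) =
       (SUP \<alpha>\<in>C12. Pstar_obj c \<gamma> \<Phi> lam \<mu>1 \<mu>2 \<alpha>)" (is "?I = ?S")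
    and "\<bar>SUP \<alpha>\<in>C12. Pstar_obj c \<gamma> \<Phi> lam \<mu>1 \<mu>2 \<alpha>\<bar> \<noteq> \<infinity> \<Longrightarrow>
       \<exists>\<pi>\<in>P_feasible \<Omega>1 \<Omega>2 lam \<mu>1 \<mu>2. \<forall>\<pi>'\<in>P_feasible \<Omega>1 \<Omega>2 lam \<mu>1 \<mu>2.
          P_obj c \<gamma> \<Phi> lam \<pi> \<le> P_obj c \<gamma> \<Phi> lam \<pi>'"
proof -
  have weak: "?S \<le> P_obj c \<gamma> \<Phi> lam \<pi>" if "\<pi> \<in> P_feasible \<Omega>1 \<Omega>2 lam \<mu>1 \<mu>2" for \<pi>
    using that by (intro SUP_least weak_duality)
  have attained: "\<exists>\<pi>\<in>P_feasible \<Omega>1 \<Omega>2 lam \<mu>1 \<mu>2. P_obj c \<gamma> \<Phi> lam \<pi> \<le> ?S" if fin: "\<bar>?S\<bar> \<noteq> \<infinity>"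
  proof -
    obtain s where s: "?S = ereal s" using fin by auto
    then show ?thesis using dual_bound_attained[of s] SUP_upper[of _ C12 "Pstar_obj c \<gamma> \<Phi> lam \<mu>1 \<mu>2"] by auto
  qed
  then show "\<exists>\<pi>\<in>P_feasible \<Omega>1 \<Omega>2 lam \<mu>1 \<mu>2. \<forall>\<pi>'\<in>P_feasible \<Omega>1 \<Omega>2 lam \<mu>1 \<mu>2.
      P_obj c \<gamma> \<Phi> lam \<pi> \<le> P_obj c \<gamma> \<Phi> lam \<pi>'" if "\<bar>?S\<bar> \<noteq> \<infinity>"
    using weak order_trans that by blast
  show "?I = ?S"
  proof (rule antisym)
    show "?S \<le> ?I" by (intro INF_greatest weak)
    have "- \<infinity> < Pstar_obj c \<gamma> \<Phi> lam \<mu>1 \<mu>2 (\<lambda>_. 0, \<lambda>_. 0)"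
      unfolding Pstar_obj_eq_energy[OF zero_C12] by simp
    also have "\<dots> \<le> ?S" using zero_C12 by (rule SUP_upper)
    finally have "?S \<noteq> -\<infinity>" by auto
    then consider "?S = \<infinity>" | "\<bar>?S\<bar> \<noteq> \<infinity>" by (cases ?S) auto
    then show "?I \<le> ?S"
    proof cases
      case 2
      with attained obtain \<pi> where "\<pi> \<in> P_feasible \<Omega>1 \<Omega>2 lam \<mu>1 \<mu>2" "P_obj c \<gamma> \<Phi> lam \<pi> \<le> ?S" by blast
      then show ?thesis by (rule INF_lower2)
    qed simp
  qed
qed

end

theorem theorem3p1:
  fixes \<Omega>1 \<Omega>2 :: "(real ^ 'n) set"
    and lam1 lam2 \<mu>1 \<mu>2 :: "(real ^ 'n) measure"
    and c :: "(real ^ 'n) \<times> (real ^ 'n) \<Rightarrow> real"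
    and \<gamma> :: real
    and \<Phi> :: "real \<Rightarrow> ereal"
  defines "\<Omega> \<equiv> \<Omega>1 \<times> \<Omega>2"
    and "lam \<equiv> lam1 \<Otimes>\<^sub>M lam2"
    and "C12 \<equiv> cont_funs \<Omega>1 \<times> cont_funs \<Omega>2"
  assumes "compact \<Omega>1" and "compact \<Omega>2"
    and "lam1 \<in> finite_radon \<Omega>1" and "lam2 \<in> finite_radon \<Omega>2"
    and "spt lam1 = \<Omega>1" and "spt lam2 = \<Omega>2"
    and "continuous_on \<Omega> c"
    and "\<gamma> > 0"
    and "quasi_young \<Phi>"
    and "((\<lambda>t. \<Phi> t / ereal t) \<longlongrightarrow> \<infinity>) at_top"
    and "\<mu>1 \<in> prob_radon \<Omega>1" and "\<mu>2 \<in> prob_radon \<Omega>2"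
    and "absolutely_continuous lam1 \<mu>1" and "absolutely_continuous lam2 \<mu>2"
    and "ereal_integrable lam1 (\<lambda>x. \<Phi> (enn2real (RN_deriv lam1 \<mu>1 x)))"
    and "ereal_integrable lam2 (\<lambda>x. \<Phi> (enn2real (RN_deriv lam2 \<mu>2 x)))"
    and "ereal_integrable lam (\<lambda>z. convex_conj (infty_ext \<Phi>) (- c z / \<gamma>))"
  shows
    "(\<forall>\<alpha>\<in>C12. Pstar_obj c \<gamma> \<Phi> lam \<mu>1 \<mu>2 \<alpha> =
        - (Pstar_F \<mu>1 \<mu>2 \<alpha> + Pstar_G c \<gamma> \<Phi> lam (oplus \<alpha>))) \<and>
     (\<forall>\<nu>\<in>signed_radon \<Omega>.
        (\<forall>\<pi>\<in>P_feasible \<Omega>1 \<Omega>2 lam \<mu>1 \<mu>2.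
           (\<forall>A\<in>sets (borel_on \<Omega>). \<nu> A = measure \<pi> A) \<longrightarrow>
           fenchel_dual_obj C12 (Pstar_F \<mu>1 \<mu>2) (cont_funs \<Omega>) (Pstar_G c \<gamma> \<Phi> lam) oplus
             (signed_integral \<Omega> \<nu>) = P_obj c \<gamma> \<Phi> lam \<pi>) \<and>
        (\<not> (\<exists>\<pi>\<in>P_feasible \<Omega>1 \<Omega>2 lam \<mu>1 \<mu>2.
              \<forall>A\<in>sets (borel_on \<Omega>). \<nu> A = measure \<pi> A) \<longrightarrow>
           fenchel_dual_obj C12 (Pstar_F \<mu>1 \<mu>2) (cont_funs \<Omega>) (Pstar_G c \<gamma> \<Phi> lam) oplus
             (signed_integral \<Omega> \<nu>) = \<infinity>)) \<and>
     (INF \<pi>\<in>P_feasible \<Omega>1 \<Omega>2 lam \<mu>1 \<mu>2. P_obj c \<gamma> \<Phi> lam \<pi>) =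
       (SUP \<alpha>\<in>C12. Pstar_obj c \<gamma> \<Phi> lam \<mu>1 \<mu>2 \<alpha>) \<and>
     (\<bar>SUP \<alpha>\<in>C12. Pstar_obj c \<gamma> \<Phi> lam \<mu>1 \<mu>2 \<alpha>\<bar> \<noteq> \<infinity> \<longrightarrow>
       (\<exists>\<pi>\<in>P_feasible \<Omega>1 \<Omega>2 lam \<mu>1 \<mu>2. \<forall>\<pi>'\<in>P_feasible \<Omega>1 \<Omega>2 lam \<mu>1 \<mu>2.
          P_obj c \<gamma> \<Phi> lam \<pi> \<le> P_obj c \<gamma> \<Phi> lam \<pi>'))"
proof -
  interpret optimal_transport \<Phi> \<Omega>1 \<Omega>2 lam1 \<mu>1 lam2 \<mu>2 c \<gamma>
    using assms by unfold_locales auto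
  have "Pstar_obj c \<gamma> \<Phi> lam \<mu>1 \<mu>2 \<alpha> = - (Pstar_F \<mu>1 \<mu>2 \<alpha> + Pstar_G c \<gamma> \<Phi> lam (oplus \<alpha>))"
    if "\<alpha> \<in> C12" for \<alpha>
    using Pstar_obj_eq_energy[of \<alpha>] Pstar_F_eq[of \<alpha>] Pstar_G_eq_energy[OF oplus_\<B>[of \<alpha>]] that
    unfolding lam_def C12_def by simp
  then show ?thesis
    using fenchel_dual_obj_feasible fenchel_dual_obj_infeasible strong_duality
    unfolding \<Omega>_def lam_def C12_def by blast
qed

end
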